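(* For every $\lambda\in[0,1]$, all positive integers $m\le n$, and every $\Gamma\in(0,1]$, the competition complexity of the supply-limiting VCG auction in the $m$-unit, $n$-buyer market over the class $\mathcal F_{(\lambda\text{-Reg})}$ of $\lambda$-regular distributions coincides with that over the class $\mathcal F^*_{(\lambda)}$ of truncated $\lambda$-generalized Pareto distributions: $$\mathrm{CC}^{\mathrm{SL}}(m,n,\mathcal F_{(\lambda\text{-Reg})},\Gamma)=\mathrm{CC}^{\mathrm{SL}}(m,n,\mathcal F^*_{(\lambda)},\Gamma).$$
   Context: Distributions. A valuation distribution $F$ is a probability distribution on $[0,\infty)$; $F$ also denotes its CDF with the convention $F(v)=\Pr_{x\sim F}[x<v]$. Its support is an interval on which it has a density $f$, except that an atom at the right endpoint of the support is allowed (in particular point masses are allowed). It is assumed that some price $p\in\mathrm{supp}(F)$ maximizes $p\,(1-F(p))$ over $p\ge0$; such a maximizer is called a monopoly reserve $r^*$. For $\lambda\in[0,1]$, $F$ is $\lambda$-regular if $\lambda v-\frac{1-F(v)}{f(v)}$ is non-decreasing in $v$ on the support (excluding the possible atom at its right endpoint); $\lambda=1$ is regularity and $\lambda=0$ is the monotone hazard rate (MHR) condition. $\mathcal F_{(\lambda\text{-Reg})}$ is the class of $\lambda$-regular distributions. For $\lambda\in(0,1]$ and finite $r\in[1,(1-\lambda)^{-1/\lambda}]$ (for $\lambda=1$: $r\in[1,\infty)$), the $r$-truncated $\lambda$-generalized Pareto distribution $F_{(\lambda,r)}$ has CDF (same convention) $F_{(\lambda,r)}(v)=1-\left(\frac{r^\lambda-1}{r}v+1\right)^{-1/\lambda}$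 for $v\in[0,r]$ and $F_{(\lambda,r)}(v)=1$ for $v>r$; it has an atom of mass $1/r$ at $r$. For $\lambda=0$ and $r\in[1,e]$, $F_{(0,r)}(v)=1-r^{-v/r}$ for $v\in[0,r]$ and $1$ for $v>r$. $\mathcal F^*_{(\lambda)}$ is the set of all $F_{(\lambda,r)}$ with $r$ in the stated range. Mechanisms. In an $m$-unit, $N$-buyer market ($m\le N$) the buyers have unit demand and values drawn i.i.d. from $F$; all bid truthfully. The VCG auction selling $s\le N$ units gives one unit to each of the $s$ highest-valued buyers (ties broken arbitrarily) and each winner pays the $(s+1)$-th highest value (taken to be $0$ if $N=s$). $\mathrm{RevVCG}_{s:N}(F)$ is its expected total payment. The supply-limiting VCG auction with supply $s\in\{1,\dots,m\}$ runs the VCG auction to sell only $s$ of the $m$ units. The Bayesian-optimal mechanism with monopoly reserve $r^*$ gives one unit to each of the $m$ highest-valued buyers whose value is at least $r^*$; each winner pays the maximum of $r^*$ and the $(m+1)$-th highest value ($0$ if $N=m$). $\mathrm{RevOPT}_{m:N}(F)$ is its expected total payment. Competition complexity of the supply-limiting VCG auction: $$\mathrm{CC}^{\mathrm{SL}}(m,n,\mathcal F,\Gamma)=\min\{k\in\mathbb Z_{\ge0}:\ \exists s\in\{1,\dots,m\}\ \forall F\in\mathcal F,\ \mathrm{RevVCG}_{s:n+k}(F)\ge\Gamma\cdot\mathrm{RevOPT}_{m:n}(F)\}$$ (and $\infty$ if no such $k$ exists). *)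

theory Defs
  imports "HOL-Probability.Probability" "HOL-Library.Extended_Nat"
begin

section \<open>Valuation distributions\<close>

text \<open>The strict convention: the library's \<^const>\<open>cdf\<close> uses \<open>{..v}\<close> instead.\<close>

definition cdf_less :: "real measure \<Rightarrow> real \<Rightarrow> real" where
  "cdf_less F v = measure F {..<v}"

definition supp :: "real measure \<Rightarrow> real set" where
  "supp F = {x. \<forall>U. open U \<longrightarrow> x \<in> U \<longrightarrow> emeasure F U > 0}"

text \<open>The support without its right endpoint (nothing is removed if the support is unbounded
  above); the only possible atom sits at the removed point.\<close>

definition supp_body :: "real measure \<Rightarrow> real set" where
  "supp_body F = {x \<in> supp F. \<exists>y\<in>supp F. x < y}"

definition has_density_on_body :: "real measure \<Rightarrow> (real \<Rightarrow> real) \<Rightarrow> bool" where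
  "has_density_on_body F f \<longleftrightarrow>
     f \<in> borel_measurable borel \<and> (\<forall>x. 0 \<le> f x) \<and>
     (\<forall>A\<in>sets borel. A \<subseteq> supp_body F \<longrightarrow>
        emeasure F A = emeasure (density lborel (\<lambda>x. ennreal (f x))) A)"

definition is_monopoly_reserve :: "real measure \<Rightarrow> real \<Rightarrow> bool" where
  "is_monopoly_reserve F r \<longleftrightarrow>
     r \<in> supp F \<and> (\<forall>p\<ge>0. p * (1 - cdf_less F p) \<le> r * (1 - cdf_less F r))"

definition valuation_distribution :: "real measure \<Rightarrow> bool" where
  "valuation_distribution F \<longleftrightarrow>
     sets F = sets borel \<and> prob_space F \<and> (AE x in F. 0 \<le> x) \<and>
     is_interval (supp F) \<and> (\<exists>f. has_density_on_body F f) \<and>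
     (\<exists>r. is_monopoly_reserve F r)"

text \<open>A density is determined only up to null sets; regularity asks for a version with
  non-decreasing virtual value. The virtual value is \<open>ereal\<close>-valued because the density may vanish
  (e.g. at the left endpoint of the support, as for the density \<open>2 * x\<close> on \<open>[0, 1]\<close>), in which
  case it is \<open>-\<infinity>\<close>: on \<^const>\<open>supp_body\<close> the numerator is positive, and \<open>x / 0 = \<infinity>\<close> for positive
  \<open>x :: ereal\<close>.\<close>

definition virtual_value :: "real \<Rightarrow> real measure \<Rightarrow> (real \<Rightarrow> real) \<Rightarrow> real \<Rightarrow> ereal" where
  "virtual_value l F f v = ereal (l * v) - ereal (1 - cdf_less F v) / ereal (f v)"

definition lambda_regular :: "real \<Rightarrow> real measure set" where
  "lambda_regular l = {F. valuation_distribution F \<and>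
     (\<exists>f. has_density_on_body F f \<and> mono_on (supp_body F) (virtual_value l F f))}"


section \<open>Truncated generalized Pareto distributions\<close>

definition gpd_cdf :: "real \<Rightarrow> real \<Rightarrow> real \<Rightarrow> real" where
  "gpd_cdf l r v =
     (if v < 0 then 0
      else if v > r then 1
      else if l = 0 then 1 - r powr (- v / r)
      else 1 - ((r powr l - 1) / r * v + 1) powr (- 1 / l))"

text \<open>The case \<open>l = 1\<close> is separate: the upper bound is then infinite, whereas \<open>0 powr (-1) = 0\<close>.\<close>

definition gpd_range :: "real \<Rightarrow> real set" where
  "gpd_range l =
     (if l = 0 then {1..exp 1}
      else if l = 1 then {1..}
      else {1..(1 - l) powr (- 1 / l)})"

definition truncated_gpd :: "real \<Rightarrow> real measure set" where
  "truncated_gpd l = {F. sets F = sets borel \<and> prob_space F \<and>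
     (\<exists>r\<in>gpd_range l. \<forall>v. cdf_less F v = gpd_cdf l r v)}"


section \<open>Mechanisms and revenue\<close>

text \<open>Buyers are \<open>0, \<dots>, N - 1\<close> and \<open>v i\<close> is the value of buyer \<open>i\<close>. \<open>kth_highest k N v\<close> counts from
  \<open>k = 1\<close>.\<close>

definition kth_highest :: "nat \<Rightarrow> nat \<Rightarrow> (nat \<Rightarrow> real) \<Rightarrow> real" where
  "kth_highest k N v = (if k \<le> N then rev (sort (map v [0..<N])) ! (k - 1) else 0)"

text \<open>Ties are broken in favour of the smaller index; total payments do not depend on this.\<close>

definition top_buyers :: "nat \<Rightarrow> nat \<Rightarrow> (nat \<Rightarrow> real) \<Rightarrow> nat set" where
  "top_buyers s N v =
     {i \<in> {..<N}. card {j \<in> {..<N}. v i < v j \<or> v j = v i \<and> j < i} < s}"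

definition vcg_payment :: "nat \<Rightarrow> nat \<Rightarrow> (nat \<Rightarrow> real) \<Rightarrow> real" where
  "vcg_payment s N v = (\<Sum>i\<in>top_buyers s N v. kth_highest (s + 1) N v)"

definition opt_payment :: "real \<Rightarrow> nat \<Rightarrow> nat \<Rightarrow> (nat \<Rightarrow> real) \<Rightarrow> real" where
  "opt_payment r m N v =
     (\<Sum>i\<in>{i \<in> top_buyers m N v. r \<le> v i}. max r (kth_highest (m + 1) N v))"

text \<open>Payments are non-negative almost surely, so the expectations are taken in \<open>ennreal\<close>.\<close>

definition RevVCG :: "nat \<Rightarrow> nat \<Rightarrow> real measure \<Rightarrow> ennreal" where
  "RevVCG s N F = (\<integral>\<^sup>+ v. ennreal (vcg_payment s N v) \<partial>(\<Pi>\<^sub>M i\<in>{..<N}. F))"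

definition monopoly_reserve :: "real measure \<Rightarrow> real" where
  "monopoly_reserve F = (SOME r. is_monopoly_reserve F r)"

definition RevOPT :: "nat \<Rightarrow> nat \<Rightarrow> real measure \<Rightarrow> ennreal" where
  "RevOPT m N F =
     (\<integral>\<^sup>+ v. ennreal (opt_payment (monopoly_reserve F) m N v) \<partial>(\<Pi>\<^sub>M i\<in>{..<N}. F))"


section \<open>Competition complexity\<close>

text \<open>In \<^typ>\<open>enat\<close>, the infimum of a non-empty set is its minimum, and \<open>Inf {} = \<infinity>\<close>.\<close>

definition CC_SL :: "nat \<Rightarrow> nat \<Rightarrow> real measure set \<Rightarrow> real \<Rightarrow> enat" where
  "CC_SL m n \<F> \<Gamma> =
     Inf {enat k | k. \<exists>s\<in>{1..m}. \<forall>F\<in>\<F>. RevVCG s (n + k) F \<ge> ennreal \<Gamma> * RevOPT m n F}"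

end

theory Submission
  imports Defs
begin

text \<open>
  Write \<open>S = 1 - F\<close> for the survival function and \<open>tlog l x = (x powr l - 1) / l\<close> (\<open>ln x\<close> for
  \<open>l = 0\<close>). Regularity says that \<open>tlog l (1 / S)\<close> is convex, and it is linear for the truncated
  generalized Pareto distributions. Hence, if \<open>F\<close> is regular with reserve \<open>\<rho>\<close>, then on \<open>[0, \<rho>]\<close> it
  dominates the truncated Pareto distribution \<open>G\<close>, rescaled, whose atom sits at \<open>\<rho>\<close> with mass
  \<open>S \<rho>\<close>; that \<open>\<rho>\<close> is a reserve forces the parameter of \<open>G\<close> into its range. Coupling \<open>F\<close> and \<open>G\<close>
  through their quantile functions, the revenue collected below \<open>\<rho>\<close> is at least that of \<open>G\<close> for
  VCG and equal to that of \<open>G\<close> for the optimal mechanism. The revenue collected above \<open>\<rho>\<close> is \<open>s\<close>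
  times the excess of the \<open>(s + 1)\<close>-st highest of \<open>n + k\<close> values for VCG and \<open>m\<close> times that of
  the \<open>(m + 1)\<close>-st highest of \<open>n\<close> values for the optimum, and the point mass at \<open>1\<close>, which is a
  truncated Pareto distribution, gives \<open>s \<ge> \<Gamma> * m\<close>.
\<close>

section \<open>Order statistics and payments\<close>

text \<open>In the sorted list the entries that are at least \<open>p\<close> form a final segment,
  so its length decides the comparison. Monotonicity, scaling and measurability below argue through
  this count instead of through sorting.\<close>

lemma kth_highest_ge_iff:
  assumes "1 \<le> k" "k \<le> N"
  shows "p \<le> kth_highest k N v \<longleftrightarrow> k \<le> card {i\<in>{..<N}. p \<le> v i}"
proof -
  define xs where "xs = sort (map v [0..<N])"
  have len: "length xs = N" and srt: "sorted xs" by (simp_all add: xs_def)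
  have kth: "kth_highest k N v = xs ! (N - k)"
    using assms len by (simp add: kth_highest_def xs_def [symmetric] rev_nth)
  have "{i\<in>{..<N}. p \<le> v i} = {i. i < length (map v [0..<N]) \<and> p \<le> map v [0..<N] ! i}" by auto
  then have "card {i\<in>{..<N}. p \<le> v i} = length (filter (\<lambda>x. p \<le> x) (map v [0..<N]))"
    by (simp only: length_filter_conv_card)
  also have "\<dots> = size (mset (filter (\<lambda>x. p \<le> x) xs))"
    unfolding xs_def mset_filter mset_sort by (simp only: size_mset flip: mset_filter)
  also have "\<dots> = card {i. i < N \<and> p \<le> xs ! i}"
    by (simp only: size_mset length_filter_conv_card len)
  finally have card_eq: "card {i\<in>{..<N}. p \<le> v i} = card {i. i < N \<and> p \<le> xs ! i}" .
  show ?thesis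
  proof
    assume "p \<le> kth_highest k N v"
    then have "{N - k..<N} \<subseteq> {i. i < N \<and> p \<le> xs ! i}"
      using kth len sorted_nth_mono[OF srt, of "N - k"] by fastforce
    then have "card {N - k..<N} \<le> card {i. i < N \<and> p \<le> xs ! i}" by (intro card_mono) auto
    then show "k \<le> card {i\<in>{..<N}. p \<le> v i}" using assms card_eq by simp
  next
    assume k: "k \<le> card {i\<in>{..<N}. p \<le> v i}"
    show "p \<le> kth_highest k N v"
    proof (rule ccontr)
      assume "\<not> p \<le> kth_highest k N v"
      then have "i > N - k" if "i < N" "p \<le> xs ! i" for i
        using that kth srt len assms sorted_nth_mono[of xs i "N - k"] by fastforce
      then have "{i. i < N \<and> p \<le> xs ! i} \<subseteq> {N - k<..<N}" by auto
      then have "card {i. i < N \<and> p \<le> xs ! i} \<le> card {N - k<..<N}" by (intro card_mono) auto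
      then show False using k card_eq assms by simp
    qed
  qed
qed

lemma kth_highest_mono:
  assumes "1 \<le> k" "\<And>i. i < N \<Longrightarrow> v i \<le> w i"
  shows "kth_highest k N v \<le> kth_highest k N w"
proof (cases "k \<le> N")
  case True
  have "k \<le> card {i\<in>{..<N}. kth_highest k N v \<le> v i}"
    using kth_highest_ge_iff[OF assms(1) True, of "kth_highest k N v" v] by simp
  also have "\<dots> \<le> card {i\<in>{..<N}. kth_highest k N v \<le> w i}"
    using assms(2) by (intro card_mono) (auto intro: order_trans)
  finally show ?thesis using kth_highest_ge_iff[OF assms(1) True] by simp
qed (simp add: kth_highest_def)

lemma kth_highest_cmult:
  assumes "0 < (c::real)" "1 \<le> k"
  shows "kth_highest k N (\<lambda>i. c * v i) = c * kth_highest k N v"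
proof (cases "k \<le> N")
  case True
  have "p \<le> kth_highest k N (\<lambda>i. c * v i) \<longleftrightarrow> p \<le> c * kth_highest k N v" for p
    using kth_highest_ge_iff[OF assms(2) True, of p "\<lambda>i. c * v i"]
      kth_highest_ge_iff[OF assms(2) True, of "p / c" v] assms(1)
    by (simp add: pos_divide_le_eq mult.commute)
  then show ?thesis by (meson order_antisym order_refl)
qed (simp add: kth_highest_def)

lemma kth_highest_eq_0: "N < k \<Longrightarrow> kth_highest k N v = 0"
  by (simp add: kth_highest_def)

lemma kth_highest_const:
  assumes "1 \<le> k"
  shows "kth_highest k N (\<lambda>_. x) = (if k \<le> N then x else 0)"
proof (cases "k \<le> N")
  case True
  have "p \<le> kth_highest k N (\<lambda>_. x) \<longleftrightarrow> p \<le> x" for p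
    using assms True kth_highest_ge_iff[OF assms True, of p "\<lambda>_. x"] by (cases "p \<le> x") auto
  then have "kth_highest k N (\<lambda>_. x) = x" by (meson order_antisym order_refl)
  then show ?thesis using True by simp
qed (simp add: kth_highest_eq_0)

text \<open>Serves to compare excesses over the reserve in the two markets. The bound
  \<open>k' \<le> N'\<close> matters: without it the left side is the default 0, which may exceed a
  negative order statistic.\<close>

lemma kth_highest_more_buyers:
  assumes "1 \<le> k" "k \<le> k'" "k' \<le> N'" "N' \<le> N"
  shows "kth_highest k' N' v \<le> kth_highest k N v"
proof -
  have "k \<le> k'" by fact
  also have "k' \<le> card {i\<in>{..<N'}. kth_highest k' N' v \<le> v i}"
    using kth_highest_ge_iff[of k' N' "kth_highest k' N' v" v] assms by simp
  also have "\<dots> \<le> card {i\<in>{..<N}. kth_highest k' N' v \<le> v i}"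
    using assms by (intro card_mono) auto
  finally show ?thesis using kth_highest_ge_iff[of k N "kth_highest k' N' v" v] assms by simp
qed

lemma kth_highest_cong:
  "(\<And>i. i < N \<Longrightarrow> v i = w i) \<Longrightarrow> kth_highest k N v = kth_highest k N w"
  unfolding kth_highest_def by (subst map_cong[of "[0..<N]" "[0..<N]" v w]) simp_all

text \<open>The set of buyers satisfying \<open>P\<close> is upward closed, so everyone ranked
  before a member is a member. Ranks therefore map this set bijectively onto an initial segment of
  the naturals, and \<open>m\<close> of them, or all, have rank below \<open>m\<close>. Both payment
  formulas are instances.\<close>

lemma card_top_buyers_restrict:
  assumes "\<And>i j. i < N \<Longrightarrow> j < N \<Longrightarrow> P i \<Longrightarrow> v i \<le> v j \<Longrightarrow> P j"
  shows "card {i\<in>top_buyers m N v. P i} = min m (card {i\<in>{..<N}. P i})"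
proof -
  define T where "T = {i\<in>{..<N}. P i}"
  define better where "better i = {j \<in> {..<N}. v i < v j \<or> v j = v i \<and> j < i}" for i
  define rk where "rk i = card (better i)" for i
  have finT: "finite T" and finB: "finite (better i)" for i by (simp_all add: T_def better_def)
  have less: "rk j < rk i" if "j \<in> better i" for i j
    unfolding rk_def using that finB by (intro psubset_card_mono) (auto simp: better_def)
  have inj: "inj_on rk T"
  proof (rule inj_onI)
    fix i j assume "i \<in> T" "j \<in> T" "rk i = rk j"
    moreover have "i = j \<or> i \<in> better j \<or> j \<in> better i" if "i \<in> T" "j \<in> T"
      using that by (auto simp: better_def T_def)
    ultimately show "i = j" using less by force
  qed
  have "rk ` T \<subseteq> {..<card T}"
  proof safe
    fix i assume i: "i \<in> T"
    have "P j" if "j \<in> better i" for j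
      using that i assms[of i j] by (auto simp: better_def T_def)
    then have "better i \<subset> T" using i by (auto simp: better_def T_def)
    then show "rk i < card T" unfolding rk_def by (rule psubset_card_mono[OF finT])
  qed
  then have img: "rk ` T = {..<card T}"
    using inj by (intro card_subset_eq) (simp_all add: card_image)
  have "card {i\<in>T. rk i < m} = card (rk ` {i\<in>T. rk i < m})"
    using inj by (intro card_image [symmetric]) (auto simp: inj_on_def)
  also have "rk ` {i\<in>T. rk i < m} = {y\<in>rk ` T. y < m}" by auto
  also have "\<dots> = {..<min m (card T)}" unfolding img by auto
  finally have "card {i\<in>T. rk i < m} = min m (card T)" by simp
  moreover have "{i\<in>top_buyers m N v. P i} = {i\<in>T. rk i < m}"
    by (auto simp: top_buyers_def T_def rk_def better_def)
  ultimately show ?thesis by (simp add: T_def)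
qed

lemma vcg_payment_eq:
  assumes "s \<le> N" shows "vcg_payment s N v = real s * kth_highest (s + 1) N v"
  using card_top_buyers_restrict[of N "\<lambda>_. True" v s] assms by (simp add: vcg_payment_def)

lemma opt_payment_eq:
  "opt_payment r m N v
     = real (min m (card {i\<in>{..<N}. r \<le> v i})) * max r (kth_highest (m + 1) N v)"
  using card_top_buyers_restrict[of N "\<lambda>i. r \<le> v i" v m] unfolding opt_payment_def by simp

lemma opt_payment_cong:
  assumes "\<And>i. i < N \<Longrightarrow> v i = w i"
  shows "opt_payment r m N v = opt_payment r m N w"
proof -
  have "{i\<in>{..<N}. r \<le> v i} = {i\<in>{..<N}. r \<le> w i}" using assms by auto
  then show ?thesis using kth_highest_cong[of N v w, OF assms] by (simp add: opt_payment_eq)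
qed

section \<open>Measurability of order statistics and payments\<close>

lemma measurable_card_ge [measurable]:
  fixes v :: "'a \<Rightarrow> nat \<Rightarrow> real"
  assumes [measurable]: "\<And>i. i < N \<Longrightarrow> (\<lambda>x. v x i) \<in> borel_measurable M"
  shows "(\<lambda>x. card {i\<in>{..<N}. p \<le> v x i}) \<in> measurable M (count_space UNIV)"
proof -
  have "{i\<in>{..<N}. p \<le> v x i} = {i. i < N \<and> p \<le> v x i}" for x by auto
  then have "card {i\<in>{..<N}. p \<le> v x i} = (\<Sum>i<N. if p \<le> v x i then 1 else 0)" for x
    by (simp add: sum.If_cases Int_def)
  then show ?thesis by simp
qed

text \<open>Stated for a family of random variables, so that it covers both the values themselves
  and quantile functions applied to coordinates.\<close>

lemma borel_measurable_kth_highest: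
  fixes v :: "'a \<Rightarrow> nat \<Rightarrow> real"
  assumes [measurable]: "\<And>i. i < N \<Longrightarrow> (\<lambda>x. v x i) \<in> borel_measurable M" and "1 \<le> k"
  shows "(\<lambda>x. kth_highest k N (v x)) \<in> borel_measurable M"
proof (cases "k \<le> N")
  case True
  show ?thesis unfolding borel_measurable_iff_ge kth_highest_ge_iff[OF \<open>1 \<le> k\<close> True] by measurable
qed (simp add: kth_highest_def)

lemma borel_measurable_opt_payment:
  fixes v :: "'a \<Rightarrow> nat \<Rightarrow> real"
  assumes [measurable]: "\<And>i. i < N \<Longrightarrow> (\<lambda>x. v x i) \<in> borel_measurable M"
  shows "(\<lambda>x. opt_payment r m N (v x)) \<in> borel_measurable M"
proof -
  have [measurable]: "(\<lambda>x. kth_highest (m + 1) N (v x)) \<in> borel_measurable M"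
    by (rule borel_measurable_kth_highest) auto
  show ?thesis unfolding opt_payment_eq by measurable
qed

section \<open>Deformed logarithm and exponential\<close>

text \<open>The Box-Cox transform, or Tsallis logarithm with index \<open>1 - l\<close>;
  \<open>l = 0\<close> is its limit.\<close>

definition tlog :: "real \<Rightarrow> real \<Rightarrow> real" where
  "tlog l x = (if l = 0 then ln x else (x powr l - 1) / l)"

text \<open>Inverse of \<open>tlog l\<close> where \<open>0 < 1 + l * z\<close>, which is why this
  side condition accompanies its later uses.\<close>

definition texp :: "real \<Rightarrow> real \<Rightarrow> real" where
  "texp l z = (if l = 0 then exp z else (1 + l * z) powr (1 / l))"

lemma tlog_1 [simp]: "tlog l 1 = 0"
  by (simp add: tlog_def)

lemma texp_0 [simp]: "texp l 0 = 1"
  by (simp add: texp_def)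

lemma tlog_texp: "0 < 1 + l * z \<Longrightarrow> tlog l (texp l z) = z"
  by (simp add: tlog_def texp_def powr_powr)

lemma one_plus_mult_tlog: "0 < x \<Longrightarrow> 1 + l * tlog l x = x powr l"
  by (simp add: tlog_def)

lemma texp_tlog: "0 < x \<Longrightarrow> texp l (tlog l x) = x"
  by (simp add: tlog_def texp_def powr_powr)

lemma texp_pos: "0 < 1 + l * z \<Longrightarrow> 0 < texp l z"
  by (auto simp: texp_def)

text \<open>The deformed functional equation of the logarithm, from
  \<open>(x y)^l - 1 = (x^l - 1) + x^l (y^l - 1)\<close>.\<close>

lemma tlog_mult: "0 < x \<Longrightarrow> 0 < y \<Longrightarrow> tlog l (x * y) = tlog l x + x powr l * tlog l y"
  by (simp add: tlog_def ln_mult powr_mult field_simps)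

lemma tlog_less_iff: "0 \<le> l \<Longrightarrow> 0 < x \<Longrightarrow> 0 < y \<Longrightarrow> tlog l x < tlog l y \<longleftrightarrow> x < y"
  using powr_less_mono2[of l x y] powr_mono2[of l y x]
  by (cases "x < y") (auto simp: tlog_def field_simps not_less divide_le_cancel)

lemma tlog_le_iff: "0 \<le> l \<Longrightarrow> 0 < x \<Longrightarrow> 0 < y \<Longrightarrow> tlog l x \<le> tlog l y \<longleftrightarrow> x \<le> y"
  using tlog_less_iff[of l y x] by (simp add: not_less [symmetric])

lemma tlog_pos_iff: "0 \<le> l \<Longrightarrow> 0 < x \<Longrightarrow> 0 < tlog l x \<longleftrightarrow> 1 < x"
  using tlog_less_iff[of l 1 x] by simp

lemma tlog_nonneg_iff: "0 \<le> l \<Longrightarrow> 0 < x \<Longrightarrow> 0 \<le> tlog l x \<longleftrightarrow> 1 \<le> x"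
  using tlog_le_iff[of l 1 x] by simp

text \<open>Written as a multiple of \<open>texp l z\<close>, so that it reads as the linear
  differential equation required by the Gronwall comparison.\<close>

lemma DERIV_texp:
  assumes "0 < 1 + l * z"
  shows "(texp l has_real_derivative texp l z / (1 + l * z)) (at z)"
proof (cases "l = 0")
  case False
  have "((\<lambda>z. (1 + l * z) powr (1 / l)) has_real_derivative
      (1 / l * (1 + l * z) powr (1 / l - 1)) * l) (at z)"
    by (rule DERIV_chain2[where f="\<lambda>z. z powr (1 / l)" and g="\<lambda>z. 1 + l * z"],
        rule has_real_derivative_powr[OF assms]) (auto intro!: derivative_eq_intros)
  moreover have "(1 / l * (1 + l * z) powr (1 / l - 1)) * l = (1 + l * z) powr (1 / l) / (1 + l * z)"
    unfolding powr_diff using assms False by simp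
  moreover have "texp l = (\<lambda>z. (1 + l * z) powr (1 / l))" using False by (auto simp: texp_def)
  ultimately show ?thesis by simp
qed (simp add: texp_def[abs_def])

lemma DERIV_tlog:
  assumes "0 < x"
  shows "(tlog l has_real_derivative x powr (l - 1)) (at x)"
proof (cases "l = 0")
  case True
  then show ?thesis
    using assms DERIV_ln[OF assms] by (simp add: tlog_def[abs_def] powr_minus_divide inverse_eq_divide)
next
  case False
  then have "((\<lambda>x. (x powr l - 1) / l) has_real_derivative x powr (l - 1)) (at x)"
    using assms by (auto intro!: derivative_eq_intros)
  moreover have "tlog l = (\<lambda>x. (x powr l - 1) / l)" using False by (auto simp: tlog_def)
  ultimately show ?thesis by simp
qed

text \<open>The concave function \<open>tlog l\<close> lies below its tangent at 1. For
  \<open>l = 1\<close> it coincides with the tangent, so strictness needs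
  \<open>l < 1\<close>.\<close>

lemma tlog_le_minus_one:
  assumes "0 \<le> l" "l \<le> 1" "0 < t" "t < 1"
  shows "tlog l t \<le> t - 1" "l < 1 \<Longrightarrow> tlog l t < t - 1"
proof -
  show less: "tlog l t < t - 1" if "l < 1"
  proof -
    let ?g = "\<lambda>x. x - 1 - tlog l x"
    have deriv: "(?g has_real_derivative 1 - x powr (l - 1)) (at x)" if "0 < x" for x
      using that by (auto intro!: derivative_eq_intros DERIV_tlog)
    have "?g 1 < ?g t"
    proof (rule DERIV_neg_imp_decreasing_open[OF \<open>t < 1\<close>])
      fix x :: real assume x: "t < x" "x < 1"
      then have "1 < x powr (l - 1)"
        using assms that powr_less_mono2_neg[of "l - 1" x 1] by simp
      then show "\<exists>y. (?g has_real_derivative y) (at x) \<and> y < 0"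
        using deriv[of x] x assms by (intro exI[of _ "1 - x powr (l - 1)"]) simp
    next
      show "continuous_on {t..1} ?g"
        using assms by (intro continuous_at_imp_continuous_on ballI DERIV_isCont[OF deriv]) auto
    qed
    then show ?thesis by simp
  qed
  show "tlog l t \<le> t - 1"
  proof (cases "l = 1")
    case True
    then show ?thesis using assms by (simp add: tlog_def)
  qed (use less assms in force)
qed

text \<open>Unites the three cases of the range. After division by \<open>r\<close> the condition
  says that the chord from the origin to the graph of \<open>tlog l\<close> at \<open>r\<close> is
  at most as steep as the tangent there, a first-order condition for \<open>r\<close> to be an
  optimal price.\<close>

lemma gpd_range_iff:
  assumes "0 \<le> l" "l \<le> 1"
  shows "r \<in> gpd_range l \<longleftrightarrow> 1 \<le> r \<and> tlog l r \<le> r powr l"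
proof -
  consider "l = 0" | "l = 1" | "0 < l" "l < 1" using assms by linarith
  then show ?thesis
  proof cases
    case 1
    then show ?thesis
      using ln_ge_iff[of r 1] ln_le_cancel_iff[of r "exp 1"] by (auto simp: gpd_range_def tlog_def)
  next
    case 2
    then show ?thesis by (auto simp: gpd_range_def tlog_def)
  next
    case 3
    have "r \<le> (1 - l) powr (- 1 / l) \<longleftrightarrow> r powr l \<le> 1 / (1 - l)" if "1 \<le> r"
    proof -
      have "r \<le> (1 - l) powr (- 1 / l) \<longleftrightarrow> r powr l \<le> ((1 - l) powr (- 1 / l)) powr l"
        using that 3 powr_mono2[of l r "(1 - l) powr (- 1 / l)"] powr_less_mono2[of l "(1 - l) powr (- 1 / l)" r]
        by (cases "r \<le> (1 - l) powr (- 1 / l)") auto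
      also have "((1 - l) powr (- 1 / l)) powr l = 1 / (1 - l)"
        unfolding powr_powr using 3 by (simp add: powr_minus_divide)
      finally show ?thesis .
    qed
    then show ?thesis using 3 by (auto simp: gpd_range_def tlog_def field_simps)
  qed
qed

text \<open>Here the survival function becomes \<open>1 / texp l\<close> of a linear function,
  uniformly in \<open>l\<close>; this is the linearity of \<open>tlog l (1 / S)\<close>.\<close>

lemma gpd_cdf_eq:
  assumes "0 \<le> v" "v \<le> r" "1 \<le> r"
  shows "gpd_cdf l r v = 1 - 1 / texp l (v / r * tlog l r)"
proof (cases "l = 0")
  case True
  then show ?thesis
    using assms by (simp add: gpd_cdf_def texp_def tlog_def powr_def exp_minus inverse_eq_divide)
next
  case False
  have eq: "(r powr l - 1) / r * v + 1 = 1 + l * (v / r * tlog l r)"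
    using False by (simp add: tlog_def)
  have "gpd_cdf l r v = 1 - (1 + l * (v / r * tlog l r)) powr (- (1 / l))"
    using assms False unfolding gpd_cdf_def eq by simp
  then show ?thesis
    using False by (simp add: texp_def powr_minus_divide del: times_divide_eq_left times_divide_eq_right)
qed

lemma one_plus_mult_pos:
  assumes "0 \<le> l" "0 \<le> v" "1 \<le> r"
  shows "0 < 1 + l * (v / r * tlog l r)"
proof -
  have "0 \<le> l * (v / r * tlog l r)" using assms tlog_nonneg_iff[of l r] by simp
  then show ?thesis by linarith
qed

text \<open>The revenue of a price \<open>p < r\<close> is \<open>p / texp l (p / r * tlog l r)\<close>, and that of \<open>r\<close> is \<open>1\<close>.\<close>

lemma tlog_less_chord:
  assumes "0 \<le> l" "l \<le> 1" "1 \<le> r" "tlog l r \<le> r powr l" "0 < p" "p < r"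
  shows "tlog l p < p / r * tlog l r"
proof -
  \<comment> \<open>Splitting \<open>tlog l (r * t)\<close> with \<open>tlog_mult\<close> reduces
    the claim to the tangent bound for \<open>tlog l t\<close> at 1.\<close>
  define t where "t = p / r"
  have t: "0 < t" "t < 1" and p: "p = r * t" using assms by (auto simp: t_def)
  have rl: "0 < r powr l" using assms by simp
  have "r powr l * tlog l t < - (1 - t) * tlog l r"
  \<comment> \<open>For \<open>l = 1\<close> the tangent bound is an equality; strictness comes
    instead from \<open>r - 1 < r\<close>.\<close>
  proof (cases "l = 1")
    case True
    then have eqs: "r powr l = r" "tlog l r = r - 1" "tlog l t = t - 1"
      using assms t by (simp_all add: tlog_def)
    show ?thesis unfolding eqs using t by (simp add: algebra_simps)
  next
    case False
    then have "r powr l * tlog l t < r powr l * (t - 1)"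
      using tlog_le_minus_one[of l t] assms t rl by simp
    also have "\<dots> \<le> - (1 - t) * tlog l r"
    proof -
      have "(1 - t) * tlog l r \<le> (1 - t) * r powr l"
        using assms(4) t by (intro mult_left_mono) auto
      then show ?thesis by (simp add: algebra_simps)
    qed
    finally show ?thesis .
  qed
  moreover have "tlog l (r * t) = tlog l r + r powr l * tlog l t"
    using assms t by (intro tlog_mult) auto
  ultimately have "tlog l (r * t) < t * tlog l r" by (simp add: algebra_simps)
  then have "tlog l p < t * tlog l r" by (simp only: p)
  then show ?thesis by (simp add: t_def)
qed

text \<open>If the chord from \<open>0\<close> to \<open>r\<close> lies above the concave function \<open>tlog l\<close>, then it is not steeper
  than the tangent at \<open>r\<close>.\<close>

lemma tlog_le_powr_if_chord:
  assumes "1 \<le> r" and chord: "\<And>t. 0 < t \<Longrightarrow> t \<le> r \<Longrightarrow> tlog l t \<le> t / r * tlog l r"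
  shows "tlog l r \<le> r powr l"
proof (rule ccontr)
  assume "\<not> tlog l r \<le> r powr l"
  then have pos: "0 < tlog l r / r - r powr (l - 1)"
    using assms(1) by (simp add: powr_diff divide_strict_right_mono)
  \<comment> \<open>The gap between chord and graph is non-negative on \<open>(0, r]\<close> and
    vanishes at \<open>r\<close>, so a positive derivative there would make it negative just to the
    left.\<close>
  define f where "f t = t / r * tlog l r - tlog l t" for t
  have "((\<lambda>t. t / r * tlog l r) has_real_derivative 1 / r * tlog l r) (at r)"
    by (intro DERIV_cmult_right DERIV_cdivide DERIV_ident)
  moreover have "(tlog l has_real_derivative r powr (l - 1)) (at r)"
    using assms(1) by (intro DERIV_tlog) simp
  ultimately have "(f has_real_derivative tlog l r / r - r powr (l - 1)) (at r)"
    unfolding f_def[abs_def] by (auto dest: DERIV_diff)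
  from DERIV_pos_inc_left[OF this pos] obtain d
    where "d > 0" and d: "\<And>h. h > 0 \<Longrightarrow> h < d \<Longrightarrow> f (r - h) < f r"
      by blast
  define h where "h = min (d / 2) (r / 2)"
  have "0 < h" "h < d" "h < r" using \<open>d > 0\<close> assms(1) by (auto simp: h_def)
  then have "f (r - h) < f r" using d by blast
  moreover have "f r = 0" using assms(1) by (simp add: f_def)
  moreover have "0 \<le> f (r - h)"
    using chord[of "r - h"] \<open>0 < h\<close> \<open>h < r\<close> by (simp add: f_def)
  ultimately show False by simp
qed

section \<open>Regular distributions\<close>

text \<open>Replace \<open>S\<close> by the right side \<open>E\<close> of its integral bound: the
  derivative of \<open>E * K\<close> is \<open>\<beta> * K * (E - S)\<close>, which is non-negative,
  and \<open>E\<close> meets \<open>S\<close> at \<open>x1\<close>. Differentiability of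
  \<open>S\<close> is avoided, and its sign is left free so that \<open>- S\<close> can be inserted
  as well.\<close>

lemma gronwall_mono:
  fixes S K \<beta> :: "real \<Rightarrow> real"
  assumes "x0 \<le> x1" and S: "continuous_on {x0..x1} S" and \<beta>: "continuous_on {x0..x1} \<beta>"
    and \<beta>_nonneg: "\<And>x. x \<in> {x0..x1} \<Longrightarrow> 0 \<le> \<beta> x" and K_nonneg: "\<And>x. x \<in> {x0..x1} \<Longrightarrow> 0 \<le> K x"
    and K: "\<And>x. x \<in> {x0..x1} \<Longrightarrow> (K has_real_derivative \<beta> x * K x) (at x)"
    and bound: "\<And>x. x \<in> {x0..x1} \<Longrightarrow> S x \<le> S x1 + integral {x..x1} (\<lambda>t. \<beta> t * S t)"
  shows "S x0 * K x0 \<le> S x1 * K x1"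
proof -
  define E where "E x = S x1 + integral {x..x1} (\<lambda>t. \<beta> t * S t)" for x
  have bS: "continuous_on {x0..x1} (\<lambda>t. \<beta> t * S t)"
    using S \<beta> by (intro continuous_intros)
  have E: "(E has_real_derivative - (\<beta> x * S x)) (at x within {x0..x1})"
    if "x \<in> {x0..x1}" for x
  proof -
    have "((\<lambda>x. S x1 + integral {x..x1} (\<lambda>t. \<beta> t * S t)) has_real_derivative 0 + - (\<beta> x * S x))
        (at x within {x0..x1})"
      by (intro DERIV_add DERIV_const integral_has_real_derivative' bS that)
    then show ?thesis by (simp add: E_def[abs_def])
  qed
  have EK: "((\<lambda>x. E x * K x) has_real_derivative - (\<beta> x * S x) * K x + \<beta> x * K x * E x)
      (at x within {x0..x1})" if "x \<in> {x0..x1}" for x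
    by (rule DERIV_mult[OF E[OF that] has_field_derivative_at_within[OF K[OF that]]])
  have "S x0 * K x0 \<le> E x0 * K x0"
    using bound[of x0] K_nonneg[of x0] \<open>x0 \<le> x1\<close>
      by (intro mult_right_mono) (auto simp: E_def)
  also have "\<dots> \<le> E x1 * K x1"
  proof (rule DERIV_nonneg_imp_increasing_open[OF \<open>x0 \<le> x1\<close>])
    fix x assume x: "x0 < x" "x < x1"
    have "0 \<le> \<beta> x * K x * (E x - S x)"
      using bound[of x] K_nonneg[of x] \<beta>_nonneg[of x] x
        by (intro mult_nonneg_nonneg) (auto simp: E_def)
    moreover have "((\<lambda>x. E x * K x) has_real_derivative - (\<beta> x * S x) * K x + \<beta> x * K x * E x) (at x)"
      using EK[of x] x by (simp add: at_within_Icc_at)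
    ultimately show "\<exists>y. ((\<lambda>x. E x * K x) has_real_derivative y) (at x) \<and> 0 \<le> y"
      by (intro exI conjI) (assumption, simp add: algebra_simps)
  next
    show "continuous_on {x0..x1} (\<lambda>x. E x * K x)"
      by (rule DERIV_continuous_on[OF EK])
  qed
  also have "E x1 = S x1" by (simp add: E_def)
  finally show ?thesis .
qed

lemma nn_integral_continuous_Icc:
  fixes g :: "real \<Rightarrow> real"
  assumes "continuous_on {a..b} g" "\<And>x. x \<in> {a..b} \<Longrightarrow> 0 \<le> g x"
  shows "(\<integral>\<^sup>+x. ennreal (g x) * indicator {a..b} x \<partial>lborel) = ennreal (integral {a..b} g)"
proof -
  have int: "set_integrable lborel {a..b} g"
    by (rule borel_integrable_atLeastAtMost') fact
  have "(\<integral>\<^sup>+x. ennreal (g x) * indicator {a..b} x \<partial>lborel) = (\<integral>\<^sup>+x. ennreal (indicator {a..b} x * g x) \<partial>lborel)"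
    by (intro nn_integral_cong) (auto split: split_indicator)
  also have "\<dots> = ennreal (LINT x:{a..b}|lborel. g x)"
    using int assms(2) unfolding set_integrable_def set_lebesgue_integral_def
    by (subst nn_integral_eq_integral) (auto split: split_indicator)
  also have "(LINT x:{a..b}|lborel. g x) = integral {a..b} g"
    by (rule set_borel_integral_eq_integral(2)[OF int])
  finally show ?thesis .
qed

section \<open>Supports and the strict distribution function\<close>

lemma real_distributionI: "prob_space F \<Longrightarrow> sets F = sets borel \<Longrightarrow> real_distribution F"
  by (simp add: real_distribution_def real_distribution_axioms_def)

lemma closed_supp: "closed (supp F)"
proof -
  have "- supp F = \<Union>{U. open U \<and> emeasure F U = 0}" by (auto simp: supp_def not_gr_zero)
  then have "open (- supp F)" by auto
  then show ?thesis by (simp add: closed_def)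
qed

text \<open>The complement is the union of all open null sets, and by the Lindelof property
  countably many of them suffice.\<close>

lemma emeasure_compl_supp:
  assumes "sets F = sets borel"
  shows "emeasure F (- supp F) = 0"
proof -
  let ?C = "{U. open U \<and> emeasure F U = 0}"
  obtain C where C: "C \<subseteq> ?C" "countable C" "\<Union>C = \<Union>?C"
    using Lindelof[of ?C] by auto
  have "(\<Union>U\<in>C. U) \<in> null_sets F"
    using C assms by (intro null_sets_UN') (auto simp: null_sets_def)
  then have "emeasure F (\<Union>C) = 0" by (simp add: null_setsD1)
  moreover have "- supp F = \<Union>?C" by (auto simp: supp_def not_gr_zero)
  ultimately show ?thesis using C by simp
qed

context real_distribution
begin

lemma cdf_less_le_1: "cdf_less M v \<le> 1"
  by (simp add: cdf_less_def)

lemma cdf_less_nonneg: "0 \<le> cdf_less M v"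
  by (simp add: cdf_less_def)

lemma cdf_less_mono: "v \<le> w \<Longrightarrow> cdf_less M v \<le> cdf_less M w"
  unfolding cdf_less_def by (intro finite_measure_mono) auto

lemma cdf_less_le_cdf: "cdf_less M v \<le> cdf M v"
  unfolding cdf_less_def cdf_def by (intro finite_measure_mono) auto

lemma cdf_le_cdf_less: "v < w \<Longrightarrow> cdf M v \<le> cdf_less M w"
  unfolding cdf_less_def cdf_def by (intro finite_measure_mono) auto

lemma cdf_less_eq_cdf: "measure M {v} = 0 \<Longrightarrow> cdf_less M v = cdf M v"
  unfolding cdf_less_def cdf_def ivl_disj_un(2)[symmetric]
  by (subst finite_measure_Union) auto

lemma measure_Ico: "v \<le> w \<Longrightarrow> measure M {v..<w} = cdf_less M w - cdf_less M v"
proof -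
  assume "v \<le> w"
  then have "{v..<w} = {..<w} - {..<v}" "{..<v} \<subseteq> {..<w}" by auto
  then show ?thesis unfolding cdf_less_def by (simp only:) (subst finite_measure_Diff, auto)
qed

end

text \<open>Removes the extended reals: where the survival probability is positive, the virtual
  value is minus infinity exactly if the density vanishes, and real otherwise.\<close>

lemma virtual_value_le_iff:
  assumes "0 \<le> f v" "0 \<le> f w" "cdf_less F v < 1" "cdf_less F w < 1"
  shows "virtual_value l F f v \<le> virtual_value l F f w \<longleftrightarrow>
    f v = 0 \<or> (0 < f w \<and> l * v - (1 - cdf_less F v) / f v \<le> l * w - (1 - cdf_less F w) / f w)"
proof -
  have vv: "virtual_value l F f x = (if f x = 0 then -\<infinity> else ereal (l * x - (1 - cdf_less F x) / f x))"
    if "0 \<le> f x" "cdf_less F x < 1" for x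
    using that by (simp add: virtual_value_def zero_ereal_def[symmetric])
  show ?thesis using assms by (auto simp: vv)
qed

lemma supp_nonneg:
  assumes "sets F = sets borel" "AE x in F. 0 \<le> x" "x \<in> supp F"
  shows "0 \<le> x"
proof (rule ccontr)
  assume "\<not> 0 \<le> x"
  have "emeasure F {..<0} = 0"
    using assms(1,2) by (subst (asm) AE_iff_measurable[of "{..<0}"]) (auto dest: sets_eq_imp_space_eq)
  then show False using assms(3) \<open>\<not> 0 \<le> x\<close>
    unfolding supp_def by (auto dest!: spec[of _ "{..<0}"])
qed

text \<open>With \<open>d = S v / f v\<close>, regularity bounds the hazard rate \<open>f / S\<close> at \<open>x\<close> by \<open>1 / (d + l * (x - v))\<close>,
  from above for \<open>x \<le> v\<close> and from below for \<open>x \<ge> v\<close>. Gronwall's inequality turns this into a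
  supporting line at \<open>v\<close> of \<open>W = tlog l (1 / S)\<close>, which replaces a differentiable convexity argument.\<close>

lemma lambda_regular_tlog_chord:
  assumes F: "F \<in> lambda_regular l" and l: "0 \<le> l"
    and r: "r \<in> supp F" "0 < r" "cdf_less F r < 1" and v: "0 \<le> v" "v \<le> r"
  shows "r * tlog l (1 / (1 - cdf_less F v)) \<le> v * tlog l (1 / (1 - cdf_less F r))"
proof -
  obtain f where sets: "sets F = sets borel" and "prob_space F" and AE0: "AE x in F. 0 \<le> x"
    and ivl: "is_interval (supp F)" and dens: "has_density_on_body F f"
    and mono: "mono_on (supp_body F) (virtual_value l F f)"
    using F by (auto simp: lambda_regular_def valuation_distribution_def)
  interpret real_distribution F by (rule real_distributionI) fact+
  define S where "S x = 1 - cdf_less F x" for x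
  define W where "W x = tlog l (1 / S x)" for x
  have f_meas: "f \<in> borel_measurable borel" and f_nonneg: "\<And>x. 0 \<le> f x"
    using dens by (auto simp: has_density_on_body_def)
  have S_pos: "0 < S x" if "x \<le> r" for x
    using cdf_less_mono[OF that] r by (simp add: S_def)
  have S_le_1: "S x \<le> 1" for x using cdf_less_nonneg[of x] by (simp add: S_def)

  have supp_nonneg: "\<And>x. x \<in> supp F \<Longrightarrow> 0 \<le> x"
    by (rule supp_nonneg[OF sets AE0])
  define a where "a = Inf (supp F)"
  have bdd: "bdd_below (supp F)" using supp_nonneg by (auto intro: bdd_belowI[of _ 0])
  have a: "a \<in> supp F" unfolding a_def using closed_supp r(1) bdd by (intro closed_contains_Inf) auto
  have "0 \<le> a" using supp_nonneg a by auto
  have "a \<le> r" unfolding a_def by (rule cInf_lower[OF r(1) bdd])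
  have "{..<a} \<subseteq> - supp F" using bdd unfolding a_def by (auto dest: cInf_lower)
  then have null_a: "emeasure F {..<a} = 0"
    using emeasure_mono[of "{..<a}" "- supp F" F] emeasure_compl_supp[OF sets] closed_supp[of F] sets by simp
  then have S_a: "S x = 1" if "x \<le> a" for x
    using cdf_less_mono[OF that] cdf_less_nonneg[of x]
      by (auto simp: S_def cdf_less_def measure_def intro!: antisym)
  have body: "x \<in> supp_body F" if "a \<le> x" "x < r" for x
  proof -
    have "x \<in> supp F" using mem_is_interval_1_I[OF ivl a r(1)] that by simp
    then show ?thesis using that r(1) unfolding supp_body_def by blast
  qed
  \<comment> \<open>Half-open intervals leave out \<open>r\<close>, which may carry the atom and
    then lies outside the region described by the density.\<close>
  have mass: "ennreal (S x - S y) = (\<integral>\<^sup>+t. ennreal (f t) * indicator {x..<y} t \<partial>lborel)"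
    if "a \<le> x" "x \<le> y" "y \<le> r" for x y
  proof -
    have "ennreal (S x - S y) = emeasure F {x..<y}"
      using that by (simp add: emeasure_eq_measure measure_Ico S_def)
    also have "\<dots> = emeasure (density lborel (\<lambda>x. ennreal (f x))) {x..<y}"
      using dens body that by (auto simp: has_density_on_body_def subset_iff)
    also have "\<dots> = (\<integral>\<^sup>+t. ennreal (f t) * indicator {x..<y} t \<partial>lborel)"
      using f_meas by (subst emeasure_density) auto
    finally show ?thesis .
  qed

  have null_pt: "measure F {x} = 0" if "x < r" for x
  proof (cases "a \<le> x")
    case True
    have "emeasure F {x} = emeasure (density lborel (\<lambda>x. ennreal (f x))) {x}"
      using dens body that True by (auto simp: has_density_on_body_def)
    also have "\<dots> = 0"
      using f_meas by (subst emeasure_density) (auto intro!: nn_integral_0_iff_AE[THEN iffD2] AE_I'[of "{x}"])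
    finally show ?thesis by (simp add: measure_def)
  next
    case False
    then have "emeasure F {x} \<le> emeasure F {..<a}" using sets by (intro emeasure_mono) auto
    then show ?thesis using null_a by (simp add: measure_def)
  qed
  have cont_S: "continuous_on {a..r} S"
    unfolding continuous_on_eq_continuous_within
  proof
    fix x assume x: "x \<in> {a..r}"
    show "continuous (at x within {a..r}) S"
    proof (cases "x < r")
      case True
      have "isCont (cdf F) x" using null_pt[OF True] by (simp add: isCont_cdf)
      moreover have "\<forall>\<^sub>F y in nhds x. cdf F y = cdf_less F y"
        using eventually_nhds_in_open[of "{..<r}" x] True
        by (auto elim!: eventually_mono simp: cdf_less_eq_cdf null_pt)
      ultimately have "isCont (cdf_less F) x" by (simp add: isCont_cong)
      then have "isCont S x" unfolding S_def[abs_def] by (rule continuous_diff[OF continuous_const])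
      then show ?thesis by (rule continuous_at_imp_continuous_at_within)
    next
      case False
      then have "x = r" using x by simp
      show ?thesis
      proof (cases "a = r")
        case False
        then have "a < r" using \<open>a \<le> r\<close> by simp
        \<comment> \<open>The strict distribution function is the left limit of \<open>cdf\<close>,
          so an atom at \<open>r\<close> does not spoil continuity of \<open>S\<close> on
          \<open>{a..r}\<close>.\<close>
        have "(cdf F \<longlongrightarrow> cdf_less F r) (at_left r)"
          unfolding cdf_less_def by (rule cdf_at_left)
        moreover have "\<forall>\<^sub>F y in at_left r. cdf F y = cdf_less F y"
          by (auto simp: eventually_at_filter cdf_less_eq_cdf null_pt)
        ultimately have "(cdf_less F \<longlongrightarrow> cdf_less F r) (at_left r)"
          by (rule Lim_transform_eventually)
        then have "(S \<longlongrightarrow> S r) (at_left r)"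
          unfolding S_def[abs_def] by (rule tendsto_diff[OF tendsto_const])
        then show ?thesis
          unfolding \<open>x = r\<close> continuous_within at_within_Icc_at_left[OF \<open>a < r\<close>] .
      qed (use x in \<open>simp add: \<open>x = r\<close> continuous_within tendsto_def eventually_at_filter\<close>)
    qed
  qed

  show ?thesis
  proof (cases "v \<le> a \<or> v = r")
    case True
    then consider "v \<le> a" | "v = r" by blast
    then show ?thesis
    proof cases
      case 1
      have "0 \<le> tlog l (1 / S r)" using S_pos[of r] S_le_1[of r] l by (simp add: tlog_nonneg_iff)
      then show ?thesis using S_a[OF 1] v by (simp add: S_def)
    qed simp
  next
    case False
    then have av: "a < v" and vr: "v < r" using v by auto
    have vv_le: "virtual_value l F f x \<le> virtual_value l F f y"
      if "a \<le> x" "x \<le> y" "y < r" for x y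
      by (rule mono_onD[OF mono]) (use body that in auto)
    have vv_iff: "virtual_value l F f x \<le> virtual_value l F f y \<longleftrightarrow>
        f x = 0 \<or> (0 < f y \<and> l * x - S x / f x \<le> l * y - S y / f y)" if "x < r" "y < r" for x y
      using virtual_value_le_iff[of f x y F l] f_nonneg S_pos[of x] S_pos[of y] that by (simp add: S_def)
    show ?thesis
    proof (cases "f v = 0")
      case True
      \<comment> \<open>A virtual value of minus infinity at \<open>v\<close> forces the same at all
        earlier points of the body, so no mass lies between \<open>a\<close> and
        \<open>v\<close>.\<close>
      have "f x = 0" if "a \<le> x" "x \<le> v" for x
        using vv_le[of x v] vv_iff[of x v] True vr that by auto
      then have zero: "ennreal (f t) * indicator {a..<v} t = 0" for t
        by (cases "t \<in> {a..<v}") auto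
      have "ennreal (S a - S v) = 0" using mass[of a v] av vr unfolding zero by simp
      then have "S v = 1" using S_a[of a] S_le_1[of v] by (simp add: ennreal_eq_0_iff)
      moreover have "0 \<le> tlog l (1 / S r)"
        using S_pos[of r] S_le_1[of r] l by (simp add: tlog_nonneg_iff)
      ultimately show ?thesis using v by (simp add: S_def)
    next
      case False
      then have fv: "0 < f v" using f_nonneg[of v] by simp
      define d where "d = S v / f v"
      have d: "0 < d" using fv S_pos[of v] vr by (simp add: d_def)
      \<comment> \<open>The curve \<open>S v / K\<close> has hazard rate \<open>\<beta>\<close> and
        agrees with \<open>S\<close> at \<open>v\<close>. The facts \<open>left\<close> and
        \<open>right\<close> say that \<open>S\<close> lies below this curve at \<open>a\<close> and
        at \<open>r\<close>.\<close>
      define K where "K x = texp l ((x - v) / d)" for x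
      define \<beta> where "\<beta> x = 1 / (d + l * (x - v))" for x
      have pos_iff: "0 < 1 + l * ((x - v) / d) \<longleftrightarrow> 0 < d + l * (x - v)" for x
        using d by (auto simp: field_simps)
      have K: "(K has_real_derivative \<beta> x * K x) (at x)" if "0 < d + l * (x - v)" for x
      proof -
        have "((\<lambda>x. (x - v) / d) has_real_derivative 1 / d) (at x)"
          using d by (auto intro!: derivative_eq_intros)
        then have "(K has_real_derivative (K x / (1 + l * ((x - v) / d))) * (1 / d)) (at x)"
          unfolding K_def[abs_def] using that pos_iff[of x]
          by (intro DERIV_chain2[where f="texp l" and g="\<lambda>x. (x - v) / d"] DERIV_texp) auto
        moreover have "(K x / (1 + l * ((x - v) / d))) * (1 / d) = \<beta> x * K x"
          using d by (simp add: \<beta>_def field_simps)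
        ultimately show ?thesis by simp
      qed
      have \<beta>_cont: "continuous_on {x..y} \<beta>"
        if "\<And>t. t \<in> {x..y} \<Longrightarrow> 0 < d + l * (t - v)" for x y
        unfolding \<beta>_def using that by (intro continuous_intros) force
      have K_pos: "0 < K x" if "0 < d + l * (x - v)" for x
        using texp_pos that pos_iff[of x] by (simp add: K_def)
      have K_v: "K v = 1" by (simp add: K_def)

      \<comment> \<open>If \<open>a\<close> is too far from \<open>v\<close>, then
        \<open>K a\<close> leaves the domain where \<open>texp\<close> is an inverse; that case is
        settled in \<open>below_a\<close>.\<close>
      have left: "K a \<le> S v" if pos_a: "0 < d + l * (a - v)"
      proof -
        have pos: "0 < d + l * (x - v)" if "x \<in> {a..v}" for x
          using pos_a l mult_left_mono[of "a - v" "x - v" l] that by auto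
        have cont: "continuous_on {x..v} (\<lambda>t. \<beta> t * S t)" if "x \<in> {a..v}" for x
          using that vr pos
            by (intro continuous_intros \<beta>_cont continuous_on_subset[OF cont_S]) auto
        have "S a * K a \<le> S v * K v"
        proof (rule gronwall_mono[where \<beta>=\<beta>])
          fix x assume x: "x \<in> {a..v}"
          have "f t \<le> \<beta> t * S t" if "t \<in> {x..<v}" for t
          proof (cases "f t = 0")
            case False
            then have ft: "0 < f t" using f_nonneg[of t] by simp
            have "l * t - S t / f t \<le> l * v - d"
              using vv_le[of t v] vv_iff[of t v] False that x vr by (auto simp: d_def)
            then have "d + l * (t - v) \<le> S t / f t" by (simp add: algebra_simps)
            then show ?thesis using ft pos[of t] that x by (simp add: \<beta>_def field_simps)
          qed (use pos[of t] S_pos[of t] x vr that in \<open>auto simp: \<beta>_def\<close>)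
          then have "ennreal (S x - S v) \<le> (\<integral>\<^sup>+t. ennreal (\<beta> t * S t) * indicator {x..v} t \<partial>lborel)"
            using mass[of x v] x vr by (auto intro!: nn_integral_mono ennreal_leI split: split_indicator)
          also have "\<dots> = ennreal (integral {x..v} (\<lambda>t. \<beta> t * S t))"
            using pos S_pos vr x
            by (intro nn_integral_continuous_Icc cont) (auto simp: \<beta>_def intro!: mult_nonneg_nonneg less_imp_le)
          finally have le: "ennreal (S x - S v) \<le> ennreal (integral {x..v} (\<lambda>t. \<beta> t * S t))" .
          have "0 \<le> integral {x..v} (\<lambda>t. \<beta> t * S t)"
          proof (rule Henstock_Kurzweil_Integration.integral_nonneg)
            show "(\<lambda>t. \<beta> t * S t) integrable_on {x..v}"
              by (intro integrable_continuous_real cont x)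
            show "0 \<le> \<beta> t * S t" if "t \<in> {x..v}" for t
              using pos[of t] S_pos[of t] vr x that by (simp add: \<beta>_def)
          qed
          with le have "S x - S v \<le> integral {x..v} (\<lambda>t. \<beta> t * S t)"
            by (simp add: ennreal_le_iff)
          then show "S x \<le> S v + integral {x..v} (\<lambda>t. \<beta> t * S t)" by simp
        qed (use av vr pos K K_pos \<beta>_cont in \<open>auto intro: continuous_on_subset[OF cont_S] less_imp_le simp: \<beta>_def\<close>)
        then show ?thesis using S_a[of a] K_v by simp
      qed

      have right: "S r * K r \<le> S v"
      proof -
        have pos: "0 < d + l * (x - v)" if "x \<in> {v..r}" for x
          using d l that by (intro add_pos_nonneg mult_nonneg_nonneg) auto
        have cont: "continuous_on {x..r} (\<lambda>t. \<beta> t * S t)" if "x \<in> {v..r}" for x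
          using that av pos
            by (intro continuous_intros \<beta>_cont continuous_on_subset[OF cont_S]) auto
        \<comment> \<open>To the right of \<open>v\<close> the hazard rate is bounded from below, so
          the inequality is applied to \<open>- S\<close>.\<close>
        have "- S v * K v \<le> - S r * K r"
        proof (rule gronwall_mono[where \<beta>=\<beta> and S="\<lambda>x. - S x"])
          fix x assume x: "x \<in> {v..r}"
          have "\<beta> t * S t \<le> f t" if "t \<in> {x..<r}" for t
          proof -
            have "0 < f t" "l * v - d \<le> l * t - S t / f t"
              using vv_le[of v t] vv_iff[of v t] False that x av by (auto simp: d_def)
            moreover from this have "S t / f t \<le> d + l * (t - v)" by (simp add: algebra_simps)
            ultimately show ?thesis using pos[of t] that x by (simp add: \<beta>_def field_simps)
          qed
          \<comment> \<open>The bound is known only to the left of \<open>r\<close>; the endpoint is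
            a Lebesgue null set.\<close>
          then have "AE t in lborel. ennreal (\<beta> t * S t) * indicator {x..r} t \<le> ennreal (f t) * indicator {x..<r} t"
            using AE_lborel_singleton[of r]
              by (auto elim!: eventually_mono intro!: ennreal_leI split: split_indicator)
          then have "(\<integral>\<^sup>+t. ennreal (\<beta> t * S t) * indicator {x..r} t \<partial>lborel) \<le> ennreal (S x - S r)"
            using mass[of x r] x av by (auto intro: nn_integral_mono_AE)
          also have "(\<integral>\<^sup>+t. ennreal (\<beta> t * S t) * indicator {x..r} t \<partial>lborel) = ennreal (integral {x..r} (\<lambda>t. \<beta> t * S t))"
            using pos S_pos x
            by (intro nn_integral_continuous_Icc cont) (auto simp: \<beta>_def intro!: mult_nonneg_nonneg less_imp_le)
          finally have "integral {x..r} (\<lambda>t. \<beta> t * S t) \<le> S x - S r"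
            using x cdf_less_mono[of x r] by (subst (asm) ennreal_le_iff) (auto simp: S_def)
          then show "- S x \<le> - S r + integral {x..r} (\<lambda>t. \<beta> t * - S t)" by simp
        next
          show "continuous_on {v..r} (\<lambda>x. - S x)"
            using av by (intro continuous_on_minus continuous_on_subset[OF cont_S]) auto
          show "continuous_on {v..r} \<beta>" by (rule \<beta>_cont) (rule pos)
        qed (use vr pos K K_pos in \<open>auto intro: less_imp_le simp: \<beta>_def\<close>)
        then show ?thesis using K_v by simp
      qed

      define P where "P = (1 / S v) powr l"
      have P: "0 < P" "P = 1 + l * W v"
        using S_pos[of v] vr by (simp_all add: P_def W_def one_plus_mult_tlog)
      \<comment> \<open>Under \<open>tlog l\<close> the reciprocal of the comparison curve becomes
        affine in \<open>x\<close>: it is the supporting line of \<open>W\<close> at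
        \<open>v\<close>, with slope \<open>P / d\<close>.\<close>
      have W_K: "tlog l (1 / S v * K x) = W v + P * ((x - v) / d)" if "0 < d + l * (x - v)" for x
        using that K_pos[OF that] S_pos[of v] vr pos_iff[of x]
        by (subst tlog_mult) (auto simp: W_def P_def K_def tlog_texp)
      have below_a: "W v + P * ((a - v) / d) \<le> 0"
      proof (cases "0 < d + l * (a - v)")
        case True
        then have "1 / S v * K a \<le> 1" using left S_pos[of v] vr by simp
        then have "tlog l (1 / S v * K a) \<le> tlog l 1"
          using l K_pos[OF True] S_pos[of v] vr by (subst tlog_le_iff) auto
        then show ?thesis using W_K[OF True] by simp
      next
        case False
        then have "l > 0" using d l by (cases "l = 0") auto
        have "l * (W v + P * z) = P * (1 + l * z) - 1" for z
          using P(2) by (simp add: algebra_simps)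
        then have "l * (W v + P * ((a - v) / d)) = P * (1 + l * ((a - v) / d)) - 1" .
        also have "\<dots> \<le> 0"
          using False pos_iff[of a] P(1) by (simp add: mult_nonneg_nonpos not_less order_trans[OF _ zero_le_one])
        finally show ?thesis using \<open>l > 0\<close> by (simp add: mult_le_0_iff)
      qed
      have below_r: "W v + P * ((r - v) / d) \<le> W r"
      proof -
        have pos_r: "0 < d + l * (r - v)" using d l vr by (intro add_pos_nonneg) auto
        have "1 / S v * K r \<le> 1 / S r"
          using right S_pos[of v] S_pos[of r] vr by (simp add: field_simps)
        then have "tlog l (1 / S v * K r) \<le> tlog l (1 / S r)"
          using l K_pos[OF pos_r] S_pos[of v] S_pos[of r] vr by (subst tlog_le_iff) auto
        then show ?thesis using W_K[OF pos_r] by (simp add: W_def)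
      qed
      \<comment> \<open>The line is increasing, hence non-positive at 0 as well. The bounds at 0 and
        at \<open>r\<close>, weighted by \<open>r - v\<close> and \<open>v\<close>, combine to the
        chord inequality.\<close>
      have "P * ((0 - v) / d) \<le> P * ((a - v) / d)"
        using P d \<open>0 \<le> a\<close> by (intro mult_left_mono divide_right_mono) auto
      with below_a have "W v \<le> P / d * v" by (simp add: field_simps)
      then have "(r - v) * W v \<le> (r - v) * (P / d * v)" using vr by (intro mult_left_mono) auto
      moreover have "v * (W v + P * ((r - v) / d)) \<le> v * W r"
        by (rule mult_left_mono[OF below_r v(1)])
      ultimately have "r * W v \<le> v * W r" by (simp add: algebra_simps)
      then show ?thesis by (simp add: W_def S_def)
    qed
  qed
qed

section \<open>Truncated generalized Pareto distributions\<close>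

text \<open>The space on which the library's quantile function \<open>I\<close> is defined too, so
  that both quantiles of the coupling share it.\<close>

abbreviation unif :: "real measure" where
  "unif \<equiv> restrict_space lborel {0<..<1}"

lemma prob_space_unif: "prob_space unif"
  by (auto simp: space_restrict_space emeasure_restrict_space intro!: prob_spaceI)

lemma borel_measurable_tlog [measurable]: "tlog l \<in> borel_measurable borel"
  unfolding tlog_def[abs_def] by measurable

lemma borel_measurable_texp [measurable]: "texp l \<in> borel_measurable borel"
  unfolding texp_def[abs_def] by measurable

text \<open>The minimum with \<open>r\<close> produces the atom. The point mass \<open>r = 1\<close>
  is separate because \<open>tlog l 1 = 0\<close> would make the quotient the default value
  0.\<close>

definition gpd_quantile :: "real \<Rightarrow> real \<Rightarrow> real \<Rightarrow> real" where
  "gpd_quantile l r u = (if r = 1 then 1 else min r (r * tlog l (1 / (1 - u)) / tlog l r))"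

lemma gpd_quantile_le: "gpd_quantile l r u \<le> r"
  by (simp add: gpd_quantile_def)

lemma gpd_quantile_nonneg:
  assumes "0 \<le> l" "1 \<le> r" "u \<in> {0<..<1}"
  shows "0 \<le> gpd_quantile l r u"
  using assms tlog_nonneg_iff[of l r] tlog_nonneg_iff[of l "1 / (1 - u)"]
  by (auto simp: gpd_quantile_def)

lemma measurable_gpd_quantile [measurable]: "gpd_quantile l r \<in> borel_measurable unif"
  unfolding gpd_quantile_def[abs_def] by (rule measurable_restrict_space1) simp

lemma texp_less_iff:
  assumes "0 \<le> l" "0 < 1 + l * z" "0 < x"
  shows "x < texp l z \<longleftrightarrow> tlog l x < z" "texp l z < x \<longleftrightarrow> z < tlog l x"
  using tlog_less_iff[of l x "texp l z"] tlog_less_iff[of l "texp l z" x] assms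
  by (simp_all add: texp_pos tlog_texp)

text \<open>The Galois connection in strict form, matching the strict distribution function; it
  yields both the law of the quantile and the coupling.\<close>

lemma gpd_quantile_less_iff:
  assumes "0 \<le> l" "1 \<le> r" "u \<in> {0<..<1}"
  shows "gpd_quantile l r u < v \<longleftrightarrow> u < gpd_cdf l r v"
proof -
  consider "v < 0" | "r < v" | "0 \<le> v" "v \<le> r" by linarith
  then show ?thesis
  proof cases
    case 1
    then show ?thesis using gpd_quantile_nonneg[OF assms] assms by (simp add: gpd_cdf_def)
  next
    case 2
    then show ?thesis using gpd_quantile_le[of l r u] assms by (simp add: gpd_cdf_def)
  next
    case 3
    show ?thesis
    proof (cases "r = 1")
      case True
      then show ?thesis using 3 assms by (simp add: gpd_cdf_eq gpd_quantile_def)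
    next
      case False
      then have tr: "0 < tlog l r" using assms by (simp add: tlog_pos_iff)
      have pos: "0 < 1 + l * (v / r * tlog l r)" using one_plus_mult_pos assms 3 by simp
      have "gpd_quantile l r u < v \<longleftrightarrow> r * tlog l (1 / (1 - u)) / tlog l r < v"
        using False 3 by (auto simp: gpd_quantile_def)
      also have "\<dots> \<longleftrightarrow> tlog l (1 / (1 - u)) < v / r * tlog l r"
        using tr assms by (simp add: field_simps)
      also have "\<dots> \<longleftrightarrow> 1 / (1 - u) < texp l (v / r * tlog l r)"
        using texp_less_iff(1)[OF assms(1) pos, of "1 / (1 - u)"] assms by simp
      also have "\<dots> \<longleftrightarrow> u < 1 - 1 / texp l (v / r * tlog l r)"
        using assms texp_pos[OF pos] by (auto simp: field_simps)
      finally show ?thesis using 3 assms by (simp add: gpd_cdf_eq)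
    qed
  qed
qed

lemma gpd_cdf_bounds:
  assumes "0 \<le> l" "1 \<le> r"
  shows "0 \<le> gpd_cdf l r v" "gpd_cdf l r v \<le> 1"
proof -
  have "1 \<le> texp l (v / r * tlog l r)" if "0 \<le> v"
  proof -
    have "0 \<le> v / r * tlog l r" using assms that by (simp add: tlog_nonneg_iff)
    then show ?thesis
      using texp_less_iff(2)[of l "v / r * tlog l r" 1] one_plus_mult_pos[of l v r] assms that
      by (auto simp: not_less[symmetric])
  qed
  then have "0 \<le> gpd_cdf l r v \<and> gpd_cdf l r v \<le> 1"
    using gpd_cdf_eq[of v r l] assms
    by (cases "0 \<le> v \<and> v \<le> r") (auto simp: gpd_cdf_def[of l r v])
  then show "0 \<le> gpd_cdf l r v" "gpd_cdf l r v \<le> 1" by auto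
qed

lemma cdf_less_distr_gpd_quantile:
  assumes "0 \<le> l" "1 \<le> r"
  shows "cdf_less (distr unif borel (gpd_quantile l r)) v = gpd_cdf l r v"
proof -
  have "cdf_less (distr unif borel (gpd_quantile l r)) v
      = measure unif (gpd_quantile l r -` {..<v} \<inter> space unif)"
    unfolding cdf_less_def by (subst measure_distr) auto
  also have "gpd_quantile l r -` {..<v} \<inter> space unif = {0<..<gpd_cdf l r v}"
    using gpd_quantile_less_iff[OF assms] gpd_cdf_bounds[OF assms, of v]
    by (auto simp: space_restrict_space)
  also have "measure unif \<dots> = measure lborel {0<..<gpd_cdf l r v}"
    using gpd_cdf_bounds[OF assms, of v] by (subst measure_restrict_space) auto
  also have "\<dots> = gpd_cdf l r v"
    using gpd_cdf_bounds[OF assms, of v] by simp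
  finally show ?thesis .
qed

lemma distr_gpd_quantile_in_truncated_gpd:
  assumes "0 \<le> l" "l \<le> 1" "r \<in> gpd_range l"
  shows "distr unif borel (gpd_quantile l r) \<in> truncated_gpd l"
proof -
  interpret prob_space unif by (rule prob_space_unif)
  have "1 \<le> r" using assms gpd_range_iff by auto
  then show ?thesis
    using assms cdf_less_distr_gpd_quantile[OF assms(1)] unfolding truncated_gpd_def
    by (auto intro!: prob_space_distr)
qed

text \<open>An open ray is an increasing union of closed rays, so uniqueness on open rays carries
  over. Closed rays are the complements of the sets measured by \<open>cdf_less\<close>.\<close>

lemma measure_eqI_atLeast:
  fixes M N :: "real measure"
  assumes sets: "sets M = sets borel" "sets N = sets borel"
    and fin: "\<And>x. emeasure M {x..} < \<infinity>"
    and eq: "\<And>x. emeasure M {x..} = emeasure N {x..}"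
  shows "M = N"
proof (rule measure_eqI_lessThan[OF sets])
  fix x :: real
  have inc: "incseq (\<lambda>n. {x + 1 / real (Suc n)..})"
    by (intro incseq_SucI) (auto simp: field_simps intro: order_trans[rotated])
  have Un: "(\<Union>n. {x + 1 / real (Suc n)..}) = {x<..}"
  proof safe
    fix n y assume "x + 1 / real (Suc n) \<le> y"
    then show "x < y" by (smt (verit) divide_pos_pos of_nat_0_less_iff zero_less_Suc)
  next
    fix y assume "x < y"
    then obtain n where "1 / real (Suc n) < y - x"
      using reals_Archimedean[of "y - x"] by (auto simp: inverse_eq_divide)
    then show "y \<in> (\<Union>n. {x + 1 / real (Suc n)..})" by (auto intro!: exI[of _ n])
  qed
  have sup: "emeasure K {x<..} = (SUP n. emeasure K {x + 1 / real (Suc n)..})"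
    if "sets K = sets borel" for K
    unfolding Un[symmetric]
      by (rule SUP_emeasure_incseq[OF _ inc, symmetric]) (simp add: image_subset_iff that)
  show "emeasure M {x<..} = emeasure N {x<..}" unfolding sup[OF sets(1)] sup[OF sets(2)] eq ..
  have "emeasure M {x<..} \<le> emeasure M {x..}" using sets by (intro emeasure_mono) auto
  then show "emeasure M {x<..} < \<infinity>" using fin[of x] by simp
qed

text \<open>Above \<open>r\<close> the growth is the jump at the atom, otherwise that of
  \<open>texp\<close>. For \<open>r = 1\<close> the function is constant below 1, hence the extra
  condition on \<open>v\<close>.\<close>

lemma gpd_cdf_strict:
  assumes "0 \<le> l" "1 \<le> r" "0 \<le> v" "r = 1 \<longrightarrow> 1 \<le> v" "v < w" "v \<le> r"
  shows "gpd_cdf l r v < gpd_cdf l r w"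
proof (cases "r < w")
  case True
  then show ?thesis
    using assms texp_pos[OF one_plus_mult_pos[of l v r]]
      by (simp add: gpd_cdf_eq) (simp add: gpd_cdf_def)
next
  case False
  have pos: "0 < 1 + l * (v / r * tlog l r)" "0 < 1 + l * (w / r * tlog l r)"
    using assms one_plus_mult_pos by auto
  have "0 < tlog l r" using assms False by (auto simp: tlog_pos_iff)
  then have "v / r * tlog l r < w / r * tlog l r" using assms by (simp add: divide_strict_right_mono)
  then have "texp l (v / r * tlog l r) < texp l (w / r * tlog l r)"
    using texp_less_iff(1)[OF assms(1) pos(2), of "texp l (v / r * tlog l r)"] texp_pos[OF pos(1)] tlog_texp[OF pos(1)] by simp
  then show ?thesis
    using texp_pos[OF pos(1)] False assms by (simp add: gpd_cdf_eq divide_strict_left_mono)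
qed

section \<open>Support, reserve and density of a truncated generalized Pareto distribution\<close>

locale gpd =
  fixes l r :: real and G :: "real measure"
  assumes l: "0 \<le> l" "l \<le> 1" and r: "1 \<le> r" "tlog l r \<le> r powr l"
    and sets_G: "sets G = sets borel" and prob_G: "prob_space G"
    and cdf_G: "\<And>v. cdf_less G v = gpd_cdf l r v"
begin

sublocale real_distribution G
  by (intro real_distributionI prob_G sets_G)

definition lft :: real where "lft = (if r = 1 then 1 else 0)"

lemma lft: "0 \<le> lft" "lft \<le> r" "lft < r \<longleftrightarrow> r \<noteq> 1"
  using r by (auto simp: lft_def)

lemma cdf_lft: "v \<le> lft \<Longrightarrow> gpd_cdf l r v = 0"
  using r gpd_cdf_eq[of v r l] by (cases "v < 0") (auto simp: lft_def gpd_cdf_def split: if_splits)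

lemma cdf_strict: "lft \<le> v \<Longrightarrow> v < w \<Longrightarrow> v \<le> r \<Longrightarrow> gpd_cdf l r v < gpd_cdf l r w"
  using lft l r by (intro gpd_cdf_strict) (auto simp: lft_def)

lemma supp_G: "supp G = {lft..r}"
proof (intro equalityI subsetI)
  fix x assume x: "x \<in> supp G"
  show "x \<in> {lft..r}"
  proof (rule ccontr)
    assume "x \<notin> {lft..r}"
    then consider "x < lft" | "r < x" by force
    then show False
    proof cases
      case 1
      have "emeasure G {..<lft} = 0"
        using cdf_G[of lft] cdf_lft[of lft] by (simp add: emeasure_eq_measure cdf_less_def)
      then show False using x 1 by (auto simp: supp_def dest!: spec[of _ "{..<lft}"])
    next
      case 2
      define m where "m = (r + x) / 2"
      have m: "r < m" "m < x" using 2 by (auto simp: m_def)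
      have "measure G {m..} = 1 - measure G {..<m}"
        using prob_compl[of "{..<m}"] by (simp add: Compl_eq_Diff_UNIV[symmetric])
      then have "measure G {m..} = 0"
        using m r cdf_G[of m] by (simp add: cdf_less_def gpd_cdf_def)
      moreover have "measure G {m<..} \<le> measure G {m..}" by (intro finite_measure_mono) auto
      ultimately have "emeasure G {m<..} = 0"
        by (simp add: emeasure_eq_measure measure_le_0_iff)
      then show False using x m by (auto simp: supp_def dest!: spec[of _ "{m<..}"])
    qed
  qed
next
  fix x assume x: "x \<in> {lft..r}"
  show "x \<in> supp G"
    unfolding supp_def
  proof safe
    fix U :: "real set" assume "open U" "x \<in> U"
    then obtain e where "e > 0" "ball x e \<subseteq> U" by (auto simp: open_contains_ball)
    then have sub: "{x..<x + e} \<subseteq> U" by (auto simp: subset_iff dist_real_def)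
    have "0 < measure G {x..<x + e}"
      using x \<open>e > 0\<close> cdf_strict[of x "x + e"] by (simp add: measure_Ico cdf_G)
    then have "0 < emeasure G {x..<x + e}" by (simp add: emeasure_eq_measure)
    also have "\<dots> \<le> emeasure G U" using sub \<open>open U\<close> by (intro emeasure_mono) auto
    finally show "0 < emeasure G U" .
  qed
qed

lemma supp_body_G: "supp_body G = {lft..<r}"
  using lft by (auto simp: supp_body_def supp_G)

lemma revenue_r: "r * (1 - gpd_cdf l r r) = 1"
  using r by (simp add: gpd_cdf_eq texp_tlog)

text \<open>Below \<open>r\<close> this is the strict chord inequality read through
  \<open>texp\<close>; above \<open>r\<close> nothing is sold.\<close>

lemma revenue_less:
  assumes "0 \<le> p" "p \<noteq> r"
  shows "p * (1 - gpd_cdf l r p) < 1"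
proof -
  consider "p = 0" | "0 < p" "p < r" | "r < p" using assms by linarith
  then show ?thesis
  proof cases
    case 2
    have pos: "0 < 1 + l * (p / r * tlog l r)" using l r 2 by (intro one_plus_mult_pos) auto
    have "p < texp l (p / r * tlog l r)"
      using tlog_less_chord[of l r p] l r 2 texp_less_iff(1)[OF l(1) pos, of p] by simp
    then show ?thesis using 2 r texp_pos[OF pos] by (simp add: gpd_cdf_eq)
  qed (use r in \<open>auto simp: gpd_cdf_def\<close>)
qed

text \<open>Uniqueness is the point: it determines the value of the choice operator in
  \<open>monopoly_reserve\<close>.\<close>

lemma is_monopoly_reserve_G: "is_monopoly_reserve G p \<longleftrightarrow> p = r"
proof
  assume p: "is_monopoly_reserve G p"
  then have "r * (1 - gpd_cdf l r r) \<le> p * (1 - gpd_cdf l r p)"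
    using r by (simp add: is_monopoly_reserve_def cdf_G)
  moreover have "0 \<le> p" using p lft by (simp add: is_monopoly_reserve_def supp_G)
  ultimately show "p = r" using revenue_less[of p] revenue_r by force
next
  assume "p = r"
  have "q * (1 - gpd_cdf l r q) \<le> 1" if "0 \<le> q" for q
    using revenue_less[OF that] revenue_r by (cases "q = r") auto
  then show "is_monopoly_reserve G p"
    unfolding \<open>p = r\<close>
      using revenue_r lft by (simp add: is_monopoly_reserve_def supp_G cdf_G)
qed

lemma monopoly_reserve_G: "monopoly_reserve G = r"
  by (simp add: monopoly_reserve_def is_monopoly_reserve_G)

definition rate :: real where "rate = tlog l r / r"

definition dens :: "real \<Rightarrow> real" where
  "dens t = rate / ((1 + l * (rate * t)) * texp l (rate * t))"

lemma rate_mult: "rate * t = t / r * tlog l r"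
  by (simp add: rate_def)

lemma one_plus_pos: "0 \<le> t \<Longrightarrow> 0 < 1 + l * (rate * t)"
  unfolding rate_mult by (rule one_plus_mult_pos[OF l(1) _ r(1)])

lemma rate_nonneg: "0 \<le> rate"
  using l r by (simp add: rate_def tlog_nonneg_iff)

lemma dens_nonneg: "0 \<le> t \<Longrightarrow> 0 \<le> dens t"
  unfolding dens_def using rate_nonneg one_plus_pos[of t] texp_pos[of l "rate * t"]
  by (intro divide_nonneg_nonneg mult_nonneg_nonneg) auto

lemma cdf_rate: "0 \<le> t \<Longrightarrow> t \<le> r \<Longrightarrow> gpd_cdf l r t = 1 - 1 / texp l (rate * t)"
  using r by (simp add: gpd_cdf_eq rate_mult)

lemma DERIV_dens:
  assumes "0 \<le> t"
  shows "((\<lambda>t. - 1 / texp l (rate * t)) has_real_derivative dens t) (at t)"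
proof -
  have pos: "0 < texp l (rate * t)" using one_plus_pos[OF assms] by (rule texp_pos)
  have "((\<lambda>t. rate * t) has_real_derivative rate) (at t)"
    by (auto intro!: derivative_eq_intros)
  then have D: "((\<lambda>t. texp l (rate * t)) has_real_derivative
      texp l (rate * t) / (1 + l * (rate * t)) * rate) (at t)"
    by (rule DERIV_chain2[where f="texp l" and g="\<lambda>t. rate * t",
          OF DERIV_texp[OF one_plus_pos[OF assms]]])
  have "((\<lambda>t. - 1 / texp l (rate * t)) has_real_derivative
      (0 * texp l (rate * t) - - 1 * (texp l (rate * t) / (1 + l * (rate * t)) * rate))
        / (texp l (rate * t) * texp l (rate * t))) (at t)"
    using pos by (intro DERIV_divide DERIV_const D) simp
  moreover have "(0 * texp l (rate * t) - - 1 * (texp l (rate * t) / (1 + l * (rate * t)) * rate))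
        / (texp l (rate * t) * texp l (rate * t)) = dens t"
    using pos one_plus_pos[OF assms] by (simp add: dens_def)
  ultimately show ?thesis by simp
qed

lemma dens_measurable [measurable]: "dens \<in> borel_measurable borel"
  unfolding dens_def[abs_def] by measurable

text \<open>The cut-off ensures non-negativity on the whole line; \<open>dens\<close> is controlled
  only for non-negative arguments.\<close>

definition dens0 :: "real \<Rightarrow> real" where "dens0 t = dens t * indicator {lft..<r} t"

lemma dens0_nonneg: "0 \<le> dens0 t"
  using dens_nonneg[of t] lft by (auto simp: dens0_def split: split_indicator)

lemma dens0_measurable [measurable]: "dens0 \<in> borel_measurable borel"
  unfolding dens0_def[abs_def] by measurable

text \<open>Once the atom at \<open>r\<close> is cut away, both measures agree on closed rays by the
  fundamental theorem of calculus, hence everywhere.\<close>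

lemma has_density_G: "has_density_on_body G dens0"
proof -
  have "density G (indicator {lft..<r}) = density lborel (\<lambda>t. ennreal (dens0 t))"
  proof (rule measure_eqI_atLeast)
    fix x :: real
    have "emeasure (density G (indicator {lft..<r})) {x..} = emeasure G ({x..} \<inter> {lft..<r})"
      by (subst emeasure_density) (auto simp: indicator_inter_arith[symmetric] mult.commute Int_commute sets_G)
    also have "{x..} \<inter> {lft..<r} = {max x lft..<r}" by auto
    finally have 1: "emeasure (density G (indicator {lft..<r})) {x..} = emeasure G {max x lft..<r}" .
    then show "emeasure (density G (indicator {lft..<r})) {x..} < \<infinity>"
      by (simp add: emeasure_eq_measure)
    show "emeasure (density G (indicator {lft..<r})) {x..} = emeasure (density lborel (\<lambda>t. ennreal (dens0 t))) {x..}"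
    proof (cases "max x lft \<le> r")
      case True
      have "emeasure (density lborel (\<lambda>t. ennreal (dens0 t))) {x..} = (\<integral>\<^sup>+t. ennreal (dens0 t) * indicator {x..} t \<partial>lborel)"
        by (subst emeasure_density) auto
      also have "\<dots> = (\<integral>\<^sup>+t. ennreal (dens t) * indicator {max x lft..r} t \<partial>lborel)"
        using AE_lborel_singleton[of r]
        by (intro nn_integral_cong_AE) (auto elim!: eventually_mono simp: dens0_def split: split_indicator)
      also have "\<dots> = ennreal (- 1 / texp l (rate * r) - - 1 / texp l (rate * max x lft))"
        using lft True by (intro nn_integral_FTC_Icc DERIV_dens dens_nonneg) (auto simp: max_def split: if_splits)
      also have "\<dots> = ennreal (gpd_cdf l r r - gpd_cdf l r (max x lft))"
        using lft r True by (subst (1 2) cdf_rate) (auto simp: max_def)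
      also have "\<dots> = emeasure G {max x lft..<r}"
        using True by (simp add: emeasure_eq_measure measure_Ico cdf_G del: max.bounded_iff)
      finally show ?thesis using 1 by simp
    next
      case False
      then have "r < x" using lft by auto
      then have zero: "ennreal (dens0 t) * indicator {x..} t = 0" for t
        by (cases "t < r") (auto simp: dens0_def)
      have "emeasure (density lborel (\<lambda>t. ennreal (dens0 t))) {x..} = (\<integral>\<^sup>+t. ennreal (dens0 t) * indicator {x..} t \<partial>lborel)"
        by (subst emeasure_density) auto
      also have "\<dots> = 0" unfolding zero by simp
      finally show ?thesis using 1 \<open>r < x\<close> by simp
    qed
  qed (simp_all add: sets_G)
  then have "emeasure G A = emeasure (density lborel (\<lambda>t. ennreal (dens0 t))) A"
    if "A \<in> sets borel" "A \<subseteq> {lft..<r}" for A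
  proof -
    have "emeasure G A = emeasure (density G (indicator {lft..<r})) A"
      using that by (subst emeasure_density) (auto simp: indicator_inter_arith[symmetric] sets_G Int_absorb1)
    then show ?thesis using \<open>density G _ = _\<close> by simp
  qed
  then show ?thesis
    using dens0_nonneg by (auto simp: has_density_on_body_def supp_body_G)
qed

text \<open>The virtual value is constant, equal to \<open>- 1 / rate\<close>: the extreme case of
  regularity.\<close>

lemma mono_virtual_value_G: "mono_on (supp_body G) (virtual_value l G dens0)"
proof (rule mono_onI)
  fix v w assume vw: "v \<in> supp_body G" "w \<in> supp_body G" "v \<le> w"
  have *: "0 < dens0 x \<and> cdf_less G x < 1 \<and> l * x - (1 - cdf_less G x) / dens0 x = - 1 / rate"
    if "x \<in> supp_body G" for x
  proof -
    have x: "0 \<le> x" "x < r" "x \<in> {lft..<r}" using that lft by (auto simp: supp_body_G)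
    \<comment> \<open>The point mass has an empty body.\<close>
    then have "r \<noteq> 1" using lft by auto
    then have rate: "0 < rate" using l r by (simp add: rate_def tlog_pos_iff)
    have pos: "0 < 1 + l * (rate * x)" "0 < texp l (rate * x)"
      using one_plus_pos[OF x(1)] texp_pos by auto
    have dens: "dens0 x = rate / ((1 + l * (rate * x)) * texp l (rate * x))"
      using x by (simp add: dens0_def dens_def)
    have cdf: "1 - cdf_less G x = 1 / texp l (rate * x)" using x by (simp add: cdf_G cdf_rate)
    have "(1 - cdf_less G x) / dens0 x = (1 + l * (rate * x)) / rate"
      unfolding cdf dens using pos rate by simp
    also have "\<dots> = 1 / rate + l * x" using rate by (simp add: field_simps)
    finally have "l * x - (1 - cdf_less G x) / dens0 x = - 1 / rate" by simp
    moreover have "0 < dens0 x" unfolding dens using pos rate by simp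
    moreover have "0 < 1 - cdf_less G x" unfolding cdf using pos by simp
    ultimately show ?thesis by simp
  qed
  show "virtual_value l G dens0 v \<le> virtual_value l G dens0 w"
    using *[OF vw(1)] *[OF vw(2)] by (subst virtual_value_le_iff) auto
qed

lemma lambda_regular_G: "G \<in> lambda_regular l"
proof -
  have "measure G {..<0} = 0" using cdf_lft[of 0] lft cdf_G[of 0] by (simp add: cdf_less_def)
  then have "{..<0} \<in> null_sets G" by (auto simp: null_sets_def emeasure_eq_measure sets_G)
  then have "AE x in G. 0 \<le> x" by (rule AE_I') auto
  then show ?thesis
    using sets_G prob_G has_density_G mono_virtual_value_G is_monopoly_reserve_G
    by (auto simp: lambda_regular_def valuation_distribution_def supp_G is_interval_cc)
qed

end

lemma truncated_gpd_imp_gpd: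
  assumes "G \<in> truncated_gpd l" "0 \<le> l" "l \<le> 1"
  obtains r where "gpd l r G"
  using assms gpd_range_iff[OF assms(2,3)] unfolding truncated_gpd_def gpd_def by auto

lemma truncated_gpd_subset_lambda_regular:
  assumes "0 \<le> l" "l \<le> 1"
  shows "truncated_gpd l \<subseteq> lambda_regular l"
  using truncated_gpd_imp_gpd[OF _ assms] gpd.lambda_regular_G by blast

section \<open>Comparison of revenues\<close>

text \<open>Points of the product are undefined outside \<open>{..<N}\<close>, as is
  \<open>compose {..<N} X u\<close>; \<open>cong\<close> makes \<open>h\<close> insensitive to
  this.\<close>

lemma nn_integral_PiM_distr:
  fixes X :: "'a \<Rightarrow> real" and h :: "(nat \<Rightarrow> real) \<Rightarrow> real"
  assumes U: "prob_space U" and X: "X \<in> borel_measurable U"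
    and h: "h \<in> borel_measurable (\<Pi>\<^sub>M i\<in>{..<N}. borel)"
    and cong: "\<And>v w. (\<And>i. i < N \<Longrightarrow> v i = w i) \<Longrightarrow> h v = h w"
  shows "(\<integral>\<^sup>+v. ennreal (h v) \<partial>(\<Pi>\<^sub>M i\<in>{..<N}. distr U borel X))
    = (\<integral>\<^sup>+u. ennreal (h (\<lambda>i. X (u i))) \<partial>(\<Pi>\<^sub>M i\<in>{..<N}. U))"
proof -
  let ?D = "distr U borel X"
  have D: "prob_space ?D" using prob_space.prob_space_distr[OF U X] .
  have meas: "compose {..<N} X \<in> measurable (\<Pi>\<^sub>M i\<in>{..<N}. U) (\<Pi>\<^sub>M i\<in>{..<N}. ?D)"
    unfolding compose_def using X by (intro measurable_restrict) simp
  have "sets (\<Pi>\<^sub>M i\<in>{..<N}. ?D) = sets (\<Pi>\<^sub>M i\<in>{..<N}. borel)"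
    by (intro sets_PiM_cong) simp_all
  then have h_meas: "(\<lambda>v. ennreal (h v)) \<in> borel_measurable (\<Pi>\<^sub>M i\<in>{..<N}. ?D)"
    using h by (simp cong: measurable_cong_sets)
  have "distr U ?D X = ?D" by (intro distr_cong) simp_all
  then have "(\<Pi>\<^sub>M i\<in>{..<N}. ?D) = distr (\<Pi>\<^sub>M i\<in>{..<N}. U) (\<Pi>\<^sub>M i\<in>{..<N}. ?D) (compose {..<N} X)"
    using U D X by (subst distr_PiM_finite_prob_space') simp_all
  then have "(\<integral>\<^sup>+v. ennreal (h v) \<partial>(\<Pi>\<^sub>M i\<in>{..<N}. ?D))
    = (\<integral>\<^sup>+v. ennreal (h v) \<partial>distr (\<Pi>\<^sub>M i\<in>{..<N}. U) (\<Pi>\<^sub>M i\<in>{..<N}. ?D) (compose {..<N} X))"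
    by simp
  also have "\<dots> = (\<integral>\<^sup>+u. ennreal (h (compose {..<N} X u)) \<partial>(\<Pi>\<^sub>M i\<in>{..<N}. U))"
    using meas h_meas by (intro nn_integral_distr) simp_all
  also have "\<dots> = (\<integral>\<^sup>+u. ennreal (h (\<lambda>i. X (u i))) \<partial>(\<Pi>\<^sub>M i\<in>{..<N}. U))"
    using cong[of "compose {..<N} X _" "\<lambda>i. X (_ i)"] by (simp add: compose_def)
  finally show ?thesis .
qed

text \<open>The first \<open>n\<close> coordinates of the larger product have the law of the smaller
  one. This puts the markets with \<open>n\<close> and with \<open>N\<close> buyers on one
  probability space.\<close>

lemma nn_integral_PiM_initial_segment:
  fixes h :: "(nat \<Rightarrow> 'a) \<Rightarrow> ennreal"
  assumes U: "prob_space U" and "n \<le> N"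
    and h: "h \<in> borel_measurable (\<Pi>\<^sub>M i\<in>{..<n}. U)"
    and cong: "\<And>v w. (\<And>i. i < n \<Longrightarrow> v i = w i) \<Longrightarrow> h v = h w"
  shows "(\<integral>\<^sup>+u. h u \<partial>(\<Pi>\<^sub>M i\<in>{..<n}. U)) = (\<integral>\<^sup>+u. h u \<partial>(\<Pi>\<^sub>M i\<in>{..<N}. U))"
proof -
  interpret product_prob_space "\<lambda>_. U" "{..<N}"
    by (rule product_prob_spaceI) (rule U)
  have "(\<integral>\<^sup>+u. h u \<partial>(\<Pi>\<^sub>M i\<in>{..<n}. U)) = (\<integral>\<^sup>+u. h u \<partial>distr (\<Pi>\<^sub>M i\<in>{..<N}. U) (\<Pi>\<^sub>M i\<in>{..<n}. U) (\<lambda>x. restrict x {..<n}))"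
    using \<open>n \<le> N\<close> by (subst distr_PiM_restrict_finite) auto
  also have "\<dots> = (\<integral>\<^sup>+u. h (restrict u {..<n}) \<partial>(\<Pi>\<^sub>M i\<in>{..<N}. U))"
    using \<open>n \<le> N\<close> h by (intro nn_integral_distr measurable_restrict_subset) auto
  also have "\<dots> = (\<integral>\<^sup>+u. h u \<partial>(\<Pi>\<^sub>M i\<in>{..<N}. U))"
    using cong[of "restrict _ {..<n}"] by simp
  finally show ?thesis .
qed

lemma RevVCG_distr:
  assumes U: "prob_space U" and X: "X \<in> borel_measurable U" and "s \<le> N"
  shows "RevVCG s N (distr U borel X)
    = (\<integral>\<^sup>+u. ennreal (real s * kth_highest (s + 1) N (\<lambda>i. X (u i))) \<partial>(\<Pi>\<^sub>M i\<in>{..<N}. U))"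
  unfolding RevVCG_def vcg_payment_eq[OF \<open>s \<le> N\<close>]
proof (rule nn_integral_PiM_distr[OF U X])
  have "(\<lambda>v. kth_highest (s + 1) N v) \<in> borel_measurable (\<Pi>\<^sub>M i\<in>{..<N}. borel)"
    by (rule borel_measurable_kth_highest) auto
  then show "(\<lambda>v. real s * kth_highest (s + 1) N v) \<in> borel_measurable (\<Pi>\<^sub>M i\<in>{..<N}. borel)"
    by (rule borel_measurable_times[OF borel_measurable_const])
  show "real s * kth_highest (s + 1) N v = real s * kth_highest (s + 1) N w"
    if "\<And>i. i < N \<Longrightarrow> v i = w i" for v w :: "nat \<Rightarrow> real"
    using kth_highest_cong[of N v w "s + 1"] that by simp
qed

lemma RevOPT_distr:
  assumes U: "prob_space U" and X: "X \<in> borel_measurable U"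
  shows "RevOPT m N (distr U borel X)
    = (\<integral>\<^sup>+u. ennreal (opt_payment (monopoly_reserve (distr U borel X)) m N (\<lambda>i. X (u i))) \<partial>(\<Pi>\<^sub>M i\<in>{..<N}. U))"
  unfolding RevOPT_def
  by (rule nn_integral_PiM_distr[OF U X]) (auto intro!: borel_measurable_opt_payment opt_payment_cong)

text \<open>Tested on the point mass at 1: the optimum sells \<open>m\<close> units at price 1,
  while VCG earns at most \<open>s\<close>.\<close>

lemma supply_lower_bound:
  assumes l: "0 \<le> l" "l \<le> 1" and "0 \<le> \<Gamma>" "s \<le> N" "m \<le> n"
    and ineq: "\<And>G. G \<in> truncated_gpd l \<Longrightarrow> ennreal \<Gamma> * RevOPT m n G \<le> RevVCG s N G"
  shows "\<Gamma> * real m \<le> real s"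
proof -
  interpret gpd l 1 "distr unif borel (gpd_quantile l 1)"
    using l cdf_less_distr_gpd_quantile[of l 1] prob_space.prob_space_distr[OF prob_space_unif measurable_gpd_quantile]
    by (intro gpd.intro) auto
  have q: "gpd_quantile l 1 = (\<lambda>_. 1)" by (auto simp: gpd_quantile_def)
  have P: "prob_space (\<Pi>\<^sub>M i\<in>{..<k}. unif)" for k :: nat
    by (intro prob_space_PiM prob_space_unif)
  have int: "(\<integral>\<^sup>+u. c \<partial>(\<Pi>\<^sub>M i\<in>{..<k}. unif)) = c" for k :: nat and c
    using prob_space.emeasure_space_1[OF P] by simp
  have "ennreal (real m) \<le> ennreal (opt_payment 1 m n (\<lambda>_. 1))"
    using \<open>m \<le> n\<close>
      by (intro ennreal_leI) (simp add: opt_payment_eq mult_left_mono[of 1 _ "real m", simplified])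
  also have "\<dots> = RevOPT m n (distr unif borel (gpd_quantile l 1))"
    unfolding RevOPT_distr[OF prob_space_unif measurable_gpd_quantile] monopoly_reserve_G
    unfolding q int ..
  finally have "ennreal \<Gamma> * ennreal (real m) \<le> ennreal \<Gamma> * RevOPT m n (distr unif borel (gpd_quantile l 1))"
    by (intro mult_left_mono) auto
  also have "\<dots> \<le> RevVCG s N (distr unif borel (gpd_quantile l 1))"
    using l by (intro ineq distr_gpd_quantile_in_truncated_gpd) (auto simp: gpd_range_iff)
  also have "\<dots> = ennreal (real s * kth_highest (s + 1) N (\<lambda>_. 1))"
    unfolding RevVCG_distr[OF prob_space_unif measurable_gpd_quantile \<open>s \<le> N\<close>]
    unfolding q int ..
  \<comment> \<open>Only an inequality, since the price is 0 if \<open>s = N\<close>.\<close>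
  also have "kth_highest (s + 1) N (\<lambda>_. 1) \<le> 1"
    by (simp add: kth_highest_const)
  then have "ennreal (real s * kth_highest (s + 1) N (\<lambda>_. 1)) \<le> ennreal (real s)"
    by (intro ennreal_leI) (simp add: mult_left_le)
  finally show ?thesis using \<open>0 \<le> \<Gamma>\<close> by (simp add: ennreal_mult'[symmetric])
qed

text \<open>\<open>X\<close> and \<open>c * Y\<close> couple a regular distribution, with reserve \<open>\<rho> = c * r\<close>, to a scaled truncated
  generalized Pareto distribution. The revenue that \<open>X\<close> generates above \<open>\<rho>\<close> is accounted for
  separately, which is why \<open>\<Gamma> * m \<le> s\<close> is needed.\<close>

lemma revenue_comparison:
  fixes X Y :: "'a \<Rightarrow> real"
  assumes U: "prob_space U" and X: "X \<in> borel_measurable U" and Y: "Y \<in> borel_measurable U"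
    and c: "0 < c" and r: "0 \<le> r" and \<rho>: "\<rho> = c * r"
    and Y_le: "\<And>u. u \<in> space U \<Longrightarrow> Y u \<le> r" and Y_nonneg: "\<And>u. u \<in> space U \<Longrightarrow> 0 \<le> Y u"
    and YX: "\<And>u. u \<in> space U \<Longrightarrow> c * Y u \<le> X u"
    and top: "\<And>u. u \<in> space U \<Longrightarrow> \<rho> \<le> X u \<Longrightarrow> Y u = r"
    and res: "monopoly_reserve (distr U borel X) = \<rho>" "monopoly_reserve (distr U borel Y) = r"
    and params: "0 \<le> \<Gamma>" "1 \<le> s" "s \<le> m" "m \<le> n" "n \<le> N" and \<Gamma>: "\<Gamma> * real m \<le> real s"
    and ineq: "ennreal \<Gamma> * RevOPT m n (distr U borel Y) \<le> RevVCG s N (distr U borel Y)"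
  shows "ennreal \<Gamma> * RevOPT m n (distr U borel X) \<le> RevVCG s N (distr U borel X)"
proof -
  let ?P = "\<lambda>k::nat. \<Pi>\<^sub>M i\<in>{..<k}. U"
  define e where "e k N' u = max 0 (kth_highest k N' (\<lambda>i. X (u i)) - \<rho>)" for k N' :: nat and u :: "nat \<Rightarrow> 'a"
  have sN: "s \<le> N" using params by simp
  have sp: "u i \<in> space U" if "u \<in> space (?P k)" "i < k" for u :: "nat \<Rightarrow> 'a" and k i
    using that by (auto simp: space_PiM)
  have coord: "(\<lambda>u. Z (u i)) \<in> borel_measurable (?P k)"
    if "Z \<in> borel_measurable U" "i < k" for Z :: "'a \<Rightarrow> real" and k i :: nat
    using measurable_compose[OF measurable_component_singleton[of i "{..<k}" "\<lambda>_. U"] that(1)] that(2) by simp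
  have kth_meas: "(\<lambda>u. kth_highest k N' (\<lambda>i. Z (u i))) \<in> borel_measurable (?P N')"
    if "Z \<in> borel_measurable U" "1 \<le> k" for Z :: "'a \<Rightarrow> real" and k N'
    by (rule borel_measurable_kth_highest[OF coord[OF that(1)] that(2)])
  have e_meas: "e k N' \<in> borel_measurable (?P N')" if "1 \<le> k" for k N'
    unfolding e_def[abs_def] using kth_meas[OF X that] by simp
  have e_nonneg: "0 \<le> e k N' u" for k N' u by (simp add: e_def)
  have "0 \<le> \<rho>" using c r \<rho> by simp

  have kth_Y: "0 \<le> kth_highest (k + 1) N' (\<lambda>i. Y (u i))" "c * kth_highest (k + 1) N' (\<lambda>i. Y (u i)) \<le> \<rho>"
    if "u \<in> space (?P N')" for k N' u
  proof -
    have "kth_highest (k + 1) N' (\<lambda>i. 0) \<le> kth_highest (k + 1) N' (\<lambda>i. Y (u i))"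
      using Y_nonneg sp[OF that] by (intro kth_highest_mono) auto
    then show "0 \<le> kth_highest (k + 1) N' (\<lambda>i. Y (u i))"
      by (simp add: kth_highest_const)
    have "kth_highest (k + 1) N' (\<lambda>i. Y (u i)) \<le> kth_highest (k + 1) N' (\<lambda>i. r)"
      using Y_le sp[OF that] by (intro kth_highest_mono) auto
    also have "\<dots> \<le> r"
      using r by (simp add: kth_highest_const)
    finally show "c * kth_highest (k + 1) N' (\<lambda>i. Y (u i)) \<le> \<rho>" using c \<rho> by simp
  qed

  \<comment> \<open>The scaled order statistic of \<open>Y\<close> never exceeds
    \<open>\<rho>\<close>, so the excess of \<open>X\<close> over \<open>\<rho>\<close> can be added
    to it without overshooting.\<close>
  have vcg: "c * (real s * kth_highest (s + 1) N (\<lambda>i. Y (u i))) + real s * e (s + 1) N u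
      \<le> real s * kth_highest (s + 1) N (\<lambda>i. X (u i))" if u: "u \<in> space (?P N)" for u
  proof -
    have "kth_highest (s + 1) N (\<lambda>i. c * Y (u i)) \<le> kth_highest (s + 1) N (\<lambda>i. X (u i))"
      using YX sp[OF u] by (intro kth_highest_mono) auto
    then have "c * kth_highest (s + 1) N (\<lambda>i. Y (u i)) + e (s + 1) N u \<le> kth_highest (s + 1) N (\<lambda>i. X (u i))"
      using kth_Y(2)[OF u, of s] kth_highest_cmult[OF c, of "s + 1" N "\<lambda>i. Y (u i)"]
        by (simp add: e_def)
    then have "real s * (c * kth_highest (s + 1) N (\<lambda>i. Y (u i)) + e (s + 1) N u)
        \<le> real s * kth_highest (s + 1) N (\<lambda>i. X (u i))" by (rule mult_left_mono) simp
    then show ?thesis by (simp add: algebra_simps)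
  qed

  have opt_Y_nonneg: "0 \<le> opt_payment r m n (\<lambda>i. Y (u i))" for u
    using r unfolding opt_payment_eq by (intro mult_nonneg_nonneg) auto
  have opt: "opt_payment \<rho> m n (\<lambda>i. X (u i))
      \<le> c * opt_payment r m n (\<lambda>i. Y (u i)) + real m * e (m + 1) n u" if u: "u \<in> space (?P n)" for u
  proof -
    define CX where "CX = min m (card {i\<in>{..<n}. \<rho> \<le> X (u i)})"
    define CY where "CY = min m (card {i\<in>{..<n}. r \<le> Y (u i)})"
    \<comment> \<open>By \<open>top\<close>, every buyer who meets the reserve under
      \<open>X\<close> also does so under \<open>Y\<close>. Each winner pays \<open>\<rho>\<close>
      plus the excess, and there are at most \<open>m\<close> winners.\<close>
    have "card {i\<in>{..<n}. \<rho> \<le> X (u i)} \<le> card {i\<in>{..<n}. r \<le> Y (u i)}"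
      using top sp[OF u] by (intro card_mono) auto
    then have C: "real CX \<le> real CY" "real CX \<le> real m" by (auto simp: CX_def CY_def)
    have "opt_payment \<rho> m n (\<lambda>i. X (u i)) = real CX * (\<rho> + e (m + 1) n u)"
      by (simp add: opt_payment_eq CX_def e_def max_def)
    also have "\<dots> = real CX * \<rho> + real CX * e (m + 1) n u" by (simp add: algebra_simps)
    also have "\<dots> \<le> real CY * \<rho> + real m * e (m + 1) n u"
      using C \<open>0 \<le> \<rho>\<close> e_nonneg by (intro add_mono mult_right_mono) auto
    also have "real CY * \<rho> \<le> c * (real CY * max r (kth_highest (m + 1) n (\<lambda>i. Y (u i))))"
      using c mult_left_mono[of r "max r (kth_highest (m + 1) n (\<lambda>i. Y (u i)))" "c * real CY"]
      by (simp add: \<rho> mult_ac)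
    finally show ?thesis by (simp add: opt_payment_eq CY_def)
  qed

  have e_le: "e (m + 1) n u \<le> e (s + 1) N u" for u
  proof (cases "m + 1 \<le> n")
    case True
    then show ?thesis
      using kth_highest_more_buyers[of "s + 1" "m + 1" n N "\<lambda>i. X (u i)"] params
        by (auto simp: e_def)
  next
    \<comment> \<open>With \<open>m = n\<close> the price is the default 0, and the reserve is
      non-negative, so the excess vanishes.\<close>
    case False
    then show ?thesis using \<open>0 \<le> \<rho>\<close> by (simp add: e_def kth_highest_eq_0)
  qed

  define A where "A = (\<integral>\<^sup>+u. ennreal (e (m + 1) n u) \<partial>?P n)"
  define B where "B = (\<integral>\<^sup>+u. ennreal (e (s + 1) N u) \<partial>?P N)"
  have "A = (\<integral>\<^sup>+u. ennreal (e (m + 1) n u) \<partial>?P N)"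
    unfolding A_def
  proof (rule nn_integral_PiM_initial_segment[OF U \<open>n \<le> N\<close>])
    show "(\<lambda>u. ennreal (e (m + 1) n u)) \<in> borel_measurable (?P n)"
      using e_meas[of "m + 1" n] by simp
    show "ennreal (e (m + 1) n v) = ennreal (e (m + 1) n w)"
      if "\<And>i. i < n \<Longrightarrow> v i = w i" for v w :: "nat \<Rightarrow> 'a"
      using kth_highest_cong[of n "\<lambda>i. X (v i)" "\<lambda>i. X (w i)" "m + 1"] that
        by (simp add: e_def)
  qed
  also have "\<dots> \<le> B" unfolding B_def by (intro nn_integral_mono ennreal_leI e_le)
  finally have "A \<le> B" .

  have OPT: "RevOPT m n (distr U borel X) \<le> ennreal c * RevOPT m n (distr U borel Y) + ennreal (real m) * A"
  proof -
    have [measurable]: "(\<lambda>u. opt_payment r m n (\<lambda>i. Y (u i))) \<in> borel_measurable (?P n)"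
      by (rule borel_measurable_opt_payment[OF coord[OF Y]])
    note [measurable] = e_meas[of "m + 1" n, simplified]
    have "RevOPT m n (distr U borel X) = (\<integral>\<^sup>+u. ennreal (opt_payment \<rho> m n (\<lambda>i. X (u i))) \<partial>?P n)"
      by (simp add: RevOPT_distr[OF U X] res)
    also have "\<dots> \<le> (\<integral>\<^sup>+u. ennreal c * ennreal (opt_payment r m n (\<lambda>i. Y (u i))) + ennreal (real m) * ennreal (e (m + 1) n u) \<partial>?P n)"
    proof (rule nn_integral_mono)
      fix u assume "u \<in> space (?P n)"
      from ennreal_leI[OF opt[OF this]] show "ennreal (opt_payment \<rho> m n (\<lambda>i. X (u i)))
          \<le> ennreal c * ennreal (opt_payment r m n (\<lambda>i. Y (u i))) + ennreal (real m) * ennreal (e (m + 1) n u)"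
        using c opt_Y_nonneg e_nonneg
          by (simp add: ennreal_plus ennreal_mult del: ennreal_plus[symmetric])
    qed
    also have "\<dots> = ennreal c * RevOPT m n (distr U borel Y) + ennreal (real m) * A"
      by (simp add: nn_integral_add nn_integral_cmult RevOPT_distr[OF U Y] res A_def)
    finally show ?thesis .
  qed
  have VCG: "ennreal c * RevVCG s N (distr U borel Y) + ennreal (real s) * B \<le> RevVCG s N (distr U borel X)"
  proof -
    have [measurable]: "(\<lambda>u. kth_highest (Suc s) N (\<lambda>i. Y (u i))) \<in> borel_measurable (?P N)"
      using kth_meas[OF Y, of "Suc s" N] by simp
    note [measurable] = e_meas[of "s + 1" N, simplified]
    have "ennreal c * RevVCG s N (distr U borel Y) + ennreal (real s) * B
      = (\<integral>\<^sup>+u. ennreal c * ennreal (real s * kth_highest (s + 1) N (\<lambda>i. Y (u i))) + ennreal (real s) * ennreal (e (s + 1) N u) \<partial>?P N)"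
      by (simp add: nn_integral_add nn_integral_cmult RevVCG_distr[OF U Y sN] B_def)
    also have "\<dots> \<le> (\<integral>\<^sup>+u. ennreal (real s * kth_highest (s + 1) N (\<lambda>i. X (u i))) \<partial>?P N)"
    proof (rule nn_integral_mono)
      fix u assume u: "u \<in> space (?P N)"
      have "0 \<le> real s * kth_highest (s + 1) N (\<lambda>i. Y (u i))"
        using kth_Y(1)[OF u, of s] by simp
      with ennreal_leI[OF vcg[OF u]] show "ennreal c * ennreal (real s * kth_highest (s + 1) N (\<lambda>i. Y (u i))) + ennreal (real s) * ennreal (e (s + 1) N u)
          \<le> ennreal (real s * kth_highest (s + 1) N (\<lambda>i. X (u i)))"
        using c e_nonneg by (simp add: ennreal_plus ennreal_mult del: ennreal_plus[symmetric])
    qed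
    also have "\<dots> = RevVCG s N (distr U borel X)" by (simp add: RevVCG_distr[OF U X sN])
    finally show ?thesis .
  qed
  have "ennreal \<Gamma> * RevOPT m n (distr U borel X)
      \<le> ennreal \<Gamma> * (ennreal c * RevOPT m n (distr U borel Y) + ennreal (real m) * A)"
    using OPT by (intro mult_left_mono) auto
  also have "\<dots> = ennreal c * (ennreal \<Gamma> * RevOPT m n (distr U borel Y)) + ennreal (\<Gamma> * real m) * A"
    using params by (simp add: distrib_left mult_ac ennreal_mult)
  \<comment> \<open>Below the reserve the hypothesis on \<open>Y\<close> applies; above it,
    \<open>\<Gamma> * m \<le> s\<close> and \<open>A \<le> B\<close>.\<close>
  also have "\<dots> \<le> ennreal c * RevVCG s N (distr U borel Y) + ennreal (real s) * B"
    using ineq \<Gamma> \<open>A \<le> B\<close> by (intro add_mono mult_mono ennreal_leI) auto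
  also have "\<dots> \<le> RevVCG s N (distr U borel X)" by (rule VCG)
  finally show ?thesis .
qed

text \<open>The chord inequality for \<open>tlog l (1 / S)\<close>, read through
  \<open>texp\<close>. The rescaling moves the reserve \<open>\<rho>\<close> to \<open>r\<close>,
  and the choice of \<open>r\<close> gives the atom there the mass \<open>S \<rho>\<close>.\<close>

lemma gpd_cdf_dominates:
  assumes F: "F \<in> lambda_regular l" and l: "0 \<le> l"
    and \<rho>: "\<rho> \<in> supp F" "0 < \<rho>" "cdf_less F \<rho> < 1" and v: "0 \<le> v" "v \<le> \<rho>"
    and r: "r = 1 / (1 - cdf_less F \<rho>)" "1 \<le> r"
  shows "cdf_less F v \<le> gpd_cdf l r (v * r / \<rho>)"
proof -
  interpret real_distribution F
    using F by (intro real_distributionI) (auto simp: lambda_regular_def valuation_distribution_def)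
  have S: "0 < 1 - cdf_less F v" using cdf_less_mono[OF v(2)] \<rho> by simp
  have pos: "0 < 1 + l * (v / \<rho> * tlog l r)"
    using one_plus_mult_pos[of l "v * r / \<rho>" r] l v \<rho> r(2) by simp
  have "\<rho> * tlog l (1 / (1 - cdf_less F v)) \<le> v * tlog l r"
    using lambda_regular_tlog_chord[OF F l \<rho> v] r by simp
  then have "tlog l (1 / (1 - cdf_less F v)) \<le> v / \<rho> * tlog l r"
    using \<rho> by (simp add: field_simps)
  then have "1 / (1 - cdf_less F v) \<le> texp l (v / \<rho> * tlog l r)"
    using texp_less_iff(2)[OF l pos, of "1 / (1 - cdf_less F v)"] S by (simp add: not_less[symmetric])
  then have "1 / texp l (v / \<rho> * tlog l r) \<le> 1 - cdf_less F v"
    using S texp_pos[OF pos] by (simp add: field_simps)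
  moreover have "gpd_cdf l r (v * r / \<rho>) = 1 - 1 / texp l (v * r / \<rho> / r * tlog l r)"
    using v \<rho> r(2) by (intro gpd_cdf_eq) (auto simp: field_simps)
  ultimately show ?thesis using r(2) by simp
qed

lemma RevVCG_ge_if_truncated_gpd:
  assumes l: "0 \<le> l" "l \<le> 1" and F: "F \<in> lambda_regular l"
    and params: "0 \<le> \<Gamma>" "1 \<le> s" "s \<le> m" "m \<le> n" "n \<le> N"
    and ineq: "\<And>G. G \<in> truncated_gpd l \<Longrightarrow> ennreal \<Gamma> * RevOPT m n G \<le> RevVCG s N G"
  shows "ennreal \<Gamma> * RevOPT m n F \<le> RevVCG s N F"
proof -
  have sets: "sets F = sets borel" and prob: "prob_space F" and AE0: "AE x in F. 0 \<le> x"
    and "\<exists>r. is_monopoly_reserve F r"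
    using F by (auto simp: lambda_regular_def valuation_distribution_def)
  define \<rho> where "\<rho> = monopoly_reserve F"
  have res: "is_monopoly_reserve F \<rho>"
    unfolding \<rho>_def monopoly_reserve_def using \<open>\<exists>r. _\<close> by (rule someI_ex)
  then have \<rho>: "\<rho> \<in> supp F" and opt: "\<And>p. 0 \<le> p \<Longrightarrow> p * (1 - cdf_less F p) \<le> \<rho> * (1 - cdf_less F \<rho>)"
    by (auto simp: is_monopoly_reserve_def)
  have \<rho>_nonneg: "0 \<le> \<rho>" using supp_nonneg[OF sets AE0 \<rho>] .
  interpret cdf_distribution F
    unfolding cdf_distribution_def by (rule real_distributionI[OF prob sets])
  \<comment> \<open>The quantile function \<open>I\<close> of \<open>F\<close> is tied to the
    non-strict \<open>cdf\<close>, unlike \<open>gpd_quantile\<close>; passing between the two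
    conventions costs the limit arguments below.\<close>
  have X_le: "I u \<le> x \<longleftrightarrow> u \<le> cdf F x" if "u \<in> {0<..<1}" for u x
    using pseudoinverse[of u x] that by simp
  have X_meas: "I \<in> borel_measurable unif"
    using measurable_CI by (simp add: measurable_def sets_restrict_space space_restrict_space)
  have distr_X: "distr unif borel I = F" by (rule distr_I_eq_M)
  have space: "space unif = {0<..<1}" by (simp add: space_restrict_space)
  have cdf_neg: "cdf F x = 0" if "x < 0" for x
  proof -
    have "AE y in F. y \<notin> {..x}" using AE0 by (rule eventually_mono) (use that in auto)
    then show ?thesis unfolding cdf_def by (subst prob_eq_0) auto
  qed
  show ?thesis
  \<comment> \<open>With zero monopoly revenue all mass sits at 0, the optimum earns nothing, and
    there is no scale for a coupling.\<close>
  proof (cases "\<rho> * (1 - cdf_less F \<rho>) \<le> 0")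
    case True
    have one: "cdf_less F p = 1" if "0 < p" for p
    proof -
      have "p * (1 - cdf_less F p) \<le> 0" using opt[of p] that True by simp
      then show ?thesis using that cdf_less_le_1[of p] by (simp add: mult_le_0_iff)
    qed
    have "\<rho> = 0"
    proof (rule ccontr)
      assume "\<rho> \<noteq> 0"
      then have pos: "0 < \<rho> / 2" using \<rho>_nonneg by simp
      have "prob {\<rho> / 2<..} = 1 - cdf F (\<rho> / 2)"
        using prob_compl[of "{..\<rho> / 2}"] by (simp add: cdf_def Compl_eq_Diff_UNIV[symmetric])
      also have "\<dots> \<le> 0" using one[OF pos] cdf_less_le_cdf[of "\<rho> / 2"] by simp
      finally have "emeasure F {\<rho> / 2<..} = 0" by (simp add: emeasure_eq_measure measure_le_0_iff)
      then show False using \<rho> pos by (auto simp: supp_def dest!: spec[of _ "{\<rho> / 2<..}"])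
    qed
    have X: "I u \<le> 0" if "u \<in> {0<..<1}" for u
    proof (rule dense_ge)
      fix x :: real assume "0 < x"
      then show "I u \<le> x" using X_le[OF that, of x] one[of x] cdf_less_le_cdf[of x] that by simp
    qed
    have "RevOPT m n F = (\<integral>\<^sup>+u. ennreal (opt_payment 0 m n (\<lambda>i. I (u i))) \<partial>(\<Pi>\<^sub>M i\<in>{..<n}. unif))"
      using RevOPT_distr[OF prob_space_unif X_meas, of m n]
        unfolding distr_X \<rho>_def[symmetric] \<open>\<rho> = 0\<close> .
    also have "\<dots> = (\<integral>\<^sup>+u. 0 \<partial>(\<Pi>\<^sub>M i\<in>{..<n}. unif))"
    proof (rule nn_integral_cong)
      fix u :: "nat \<Rightarrow> real" assume "u \<in> space (\<Pi>\<^sub>M i\<in>{..<n}. unif)"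
      then have u: "u i \<in> {0<..<1}"
        if "i < n" for i using that by (simp add: space_PiM space PiE_iff)
      have "kth_highest (m + 1) n (\<lambda>i. I (u i)) \<le> kth_highest (m + 1) n (\<lambda>i. 0)"
        using X u by (intro kth_highest_mono) auto
      also have "\<dots> \<le> 0"
        by (simp add: kth_highest_const)
      finally show "ennreal (opt_payment 0 m n (\<lambda>i. I (u i))) = 0"
        by (simp add: opt_payment_eq)
    qed
    finally show ?thesis by simp
  next
    case False
    then have \<rho>_pos: "0 < \<rho>" and S_pos: "cdf_less F \<rho> < 1"
      using \<rho>_nonneg cdf_less_le_1[of \<rho>] by (auto simp: mult_le_0_iff)
    \<comment> \<open>The atom of mass \<open>1 / r\<close> is to match the probability of a sale at
      \<open>\<rho>\<close>. The scale \<open>c\<close> is the monopoly revenue, which normalizes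
      that of the Pareto distribution to 1.\<close>
    define r where "r = 1 / (1 - cdf_less F \<rho>)"
    define c where "c = \<rho> * (1 - cdf_less F \<rho>)"
    define Y where "Y = gpd_quantile l r"
    have r1: "1 \<le> r" using S_pos cdf_less_nonneg[of \<rho>] by (simp add: r_def)
    have c: "0 < c" and \<rho>_eq: "\<rho> = c * r" using False S_pos by (auto simp: c_def r_def)
    have dom: "cdf_less F (c * t) \<le> gpd_cdf l r t" if "0 \<le> t" "t \<le> r" for t
    proof -
      have "c * t * r / \<rho> = t" using c r1 by (simp add: \<rho>_eq)
      then show ?thesis
        using gpd_cdf_dominates[OF F l(1) \<rho> \<rho>_pos S_pos _ _ r_def r1, of "c * t"] that c
        by (simp add: \<rho>_eq)
    qed
    \<comment> \<open>Optimality of \<open>\<rho>\<close> bounds the revenue of every price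
      \<open>c * t\<close> by \<open>c\<close>. Domination transfers this to the Pareto function as
      the chord condition, which places \<open>r\<close> in its range.\<close>
    have "tlog l r \<le> r powr l"
    proof (rule tlog_le_powr_if_chord[OF r1])
      fix t assume t: "0 < t" "t \<le> r"
      have pos: "0 < 1 + l * (t / r * tlog l r)" using one_plus_mult_pos l r1 t by simp
      have "c * t * (1 - cdf_less F (c * t)) \<le> c" using opt[of "c * t"] c t by (simp add: c_def)
      then have "t * (1 - cdf_less F (c * t)) \<le> 1" using c by (simp add: mult.assoc)
      moreover have "t * (1 - gpd_cdf l r t) \<le> t * (1 - cdf_less F (c * t))"
        using dom[of t] t by (intro mult_left_mono) auto
      ultimately have "t * (1 - gpd_cdf l r t) \<le> 1" by linarith
      then have "t / texp l (t / r * tlog l r) \<le> 1" using gpd_cdf_eq[of t r l] t r1 by simp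
      then have "t \<le> texp l (t / r * tlog l r)"
        using texp_pos[OF pos] by (simp add: pos_divide_le_eq)
      then show "tlog l t \<le> t / r * tlog l r"
        using texp_less_iff(2)[OF l(1) pos t(1)] by (simp add: not_less[symmetric])
    qed
    then interpret G: gpd l r "distr unif borel Y"
      unfolding Y_def using l r1 cdf_less_distr_gpd_quantile[OF l(1) r1]
        prob_space.prob_space_distr[OF prob_space_unif measurable_gpd_quantile]
      by (intro gpd.intro) auto
    have in_G: "distr unif borel Y \<in> truncated_gpd l"
      unfolding Y_def using l r1 \<open>tlog l r \<le> r powr l\<close>
      by (intro distr_gpd_quantile_in_truncated_gpd) (simp_all add: gpd_range_iff)
    have Y_less: "Y u < v \<longleftrightarrow> u < gpd_cdf l r v" if "u \<in> {0<..<1}" for u v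
      unfolding Y_def by (rule gpd_quantile_less_iff[OF l(1) r1 that])

    have "ennreal \<Gamma> * RevOPT m n (distr unif borel I) \<le> RevVCG s N (distr unif borel I)"
    proof (rule revenue_comparison[OF prob_space_unif X_meas _ c _ \<rho>_eq])
      show "Y \<in> borel_measurable unif" unfolding Y_def by simp
      show "monopoly_reserve (distr unif borel I) = \<rho>" unfolding distr_X \<rho>_def ..
      show "monopoly_reserve (distr unif borel Y) = r" by (rule G.monopoly_reserve_G)
      show "ennreal \<Gamma> * RevOPT m n (distr unif borel Y) \<le> RevVCG s N (distr unif borel Y)"
        by (rule ineq[OF in_G])
      show "\<Gamma> * real m \<le> real s"
        using supply_lower_bound[OF l params(1) _ params(4) ineq] params by simp
      show "0 \<le> r" using r1 by simp
      show "Y u \<le> r" for u by (simp add: Y_def gpd_quantile_le)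
      show "0 \<le> Y u" if "u \<in> space unif" for u
        unfolding Y_def using gpd_quantile_nonneg[OF l(1) r1] that space by simp
    next
      fix u assume "u \<in> space unif" and top: "\<rho> \<le> I u"
      then have u: "u \<in> {0<..<1}" by (simp add: space)
      have "\<not> Y u < r"
      proof
        assume "Y u < r"
        then have "u < cdf_less F \<rho>"
          using Y_less[OF u, of r] r1 S_pos by (simp add: gpd_cdf_eq texp_tlog) (simp add: r_def)
        \<comment> \<open>As \<open>cdf_less F \<rho>\<close> is the left limit of
          \<open>cdf\<close>, some \<open>x < \<rho>\<close> already satisfies
          \<open>u < cdf F x\<close>, so the quantile stays below \<open>\<rho>\<close>.\<close>
        then have "\<forall>\<^sub>F x in at_left \<rho>. u < cdf F x"
          using order_tendstoD(1)[OF cdf_at_left[of \<rho>]] by (simp add: cdf_less_def)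
        moreover have "\<forall>\<^sub>F x in at_left \<rho>. x < \<rho>"
          by (simp add: eventually_at_filter)
        ultimately have "\<forall>\<^sub>F x in at_left \<rho>. u < cdf F x \<and> x < \<rho>"
          by (rule eventually_conj)
        then obtain x where "u < cdf F x" "x < \<rho>"
          using eventually_happens'[OF trivial_limit_at_left_real] by blast
        then show False using X_le[OF u, of x] top by simp
      qed
      then show "Y u = r" using gpd_quantile_le[of l r u] by (simp add: Y_def)
    next
      fix u assume "u \<in> space unif"
      then have u: "u \<in> {0<..<1}" by (simp add: space)
      have cdf_X: "u \<le> cdf F (I u)" using X_le[OF u, of "I u"] by simp
      have X_nonneg: "0 \<le> I u" using cdf_X u cdf_neg[of "I u"] by (cases "I u < 0") auto
      show "c * Y u \<le> I u"
      proof (rule ccontr)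
        assume "\<not> c * Y u \<le> I u"
        then have "I u / c < Y u" using c by (simp add: field_simps)
        \<comment> \<open>Two intermediate points: the step to \<open>t\<close> passes from
          \<open>cdf\<close> to \<open>cdf_less\<close>, and the step to \<open>w\<close> turns
          \<open>u \<le> gpd_cdf l r t\<close> into a strict inequality.\<close>
        then obtain t w where tw: "I u / c < t" "t < w" "w < Y u" by (meson dense)
        have "0 \<le> I u / c" using X_nonneg c by simp
        then have "0 < t" using tw by linarith
        moreover have "w < r" using tw gpd_quantile_le[of l r u] by (simp add: Y_def)
        moreover have "I u < c * t" using tw(1) c by (simp add: pos_divide_less_eq mult.commute)
        ultimately have t: "0 < t" "w < r" "I u < c * t" by simp_all
        have "u \<le> cdf_less F (c * t)" using cdf_X cdf_le_cdf_less[OF t(3)] by simp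
        also have "\<dots> \<le> gpd_cdf l r t" using dom t tw by simp
        finally have le: "u \<le> gpd_cdf l r t" .
        show False
        proof (cases "r = 1")
          \<comment> \<open>Strict growth fails below 1 for the point mass, but there its
            distribution function is 0, which is less than \<open>u\<close>.\<close>
          case True
          then show False using le u t tw by (simp add: gpd_cdf_eq)
        next
          case False
          then have "gpd_cdf l r t < gpd_cdf l r w"
            using l r1 t tw by (intro gpd_cdf_strict) auto
          then show False using le Y_less[OF u, of w] tw by simp
        qed
      qed
    qed (use params in auto)
    then show ?thesis by (simp only: distr_X)
  qed
qed

theorem proposition5p1:
  fixes l \<Gamma> :: real and m n :: nat
  assumes "0 \<le> l" and "l \<le> 1"
    and "1 \<le> m" and "m \<le> n"
    and "0 < \<Gamma>" and "\<Gamma> \<le> 1"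
  shows "CC_SL m n (lambda_regular l) \<Gamma> = CC_SL m n (truncated_gpd l) \<Gamma>"
proof -
  \<comment> \<open>The equivalence holds for each fixed supply \<open>s\<close> and each
    \<open>k\<close>, so one supply serves both classes and the two minima range over the same
    set.\<close>
  have iff: "(\<forall>F\<in>lambda_regular l. RevVCG s (n + k) F \<ge> ennreal \<Gamma> * RevOPT m n F)
      \<longleftrightarrow> (\<forall>F\<in>truncated_gpd l. RevVCG s (n + k) F \<ge> ennreal \<Gamma> * RevOPT m n F)"
    if "s \<in> {1..m}" for s k
  proof
    assume "\<forall>F\<in>lambda_regular l. RevVCG s (n + k) F \<ge> ennreal \<Gamma> * RevOPT m n F"
    then show "\<forall>F\<in>truncated_gpd l. RevVCG s (n + k) F \<ge> ennreal \<Gamma> * RevOPT m n F"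
      using truncated_gpd_subset_lambda_regular[OF assms(1,2)] by blast
  next
    assume gpd: "\<forall>F\<in>truncated_gpd l. RevVCG s (n + k) F \<ge> ennreal \<Gamma> * RevOPT m n F"
    show "\<forall>F\<in>lambda_regular l. RevVCG s (n + k) F \<ge> ennreal \<Gamma> * RevOPT m n F"
    proof
      fix F assume "F \<in> lambda_regular l"
      then show "RevVCG s (n + k) F \<ge> ennreal \<Gamma> * RevOPT m n F"
        by (rule RevVCG_ge_if_truncated_gpd[OF assms(1,2)]) (use assms that gpd in auto)
    qed
  qed
  have "(\<exists>s\<in>{1..m}. \<forall>F\<in>lambda_regular l. RevVCG s (n + k) F \<ge> ennreal \<Gamma> * RevOPT m n F)
      \<longleftrightarrow> (\<exists>s\<in>{1..m}. \<forall>F\<in>truncated_gpd l. RevVCG s (n + k) F \<ge> ennreal \<Gamma> * RevOPT m n F)" for k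
    by (intro bex_cong[OF refl] iff)
  then show ?thesis unfolding CC_SL_def by (simp only:)
qed

end
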